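(* Let $G$ be a graph with $kr$ edges, where $r$ is the rank of the cycle matroid $M(G)$, and suppose $k\ge 3$. Then the $k$-base graph $\mathfrak{G}_k(M(G))$ is connected.
   Context: The cycle matroid $M(G)$ of a graph $G$ has ground set $E(G)$ and its bases are the spanning forests of $G$ (maximal acyclic edge subsets); its rank is $|V(G)|$ minus the number of connected components of $G$. For a matroid $M$ of rank $r$ on a ground set of size $rk$, the $k$-base graph $\mathfrak{G}_k(M)$ is the graph whose vertices are the sets $\{B_1,\dots,B_k\}$ of $k$ pairwise disjoint bases of $M$, with an edge between $\{B_1,\dots,B_k\}$ and $\{D_1,\dots,D_k\}$ if and only if $B_i=D_j$ for some $i,j$. *)

theory Defs
  imports Main
begin

text \<open>A (multi)graph: finite vertex set V, finite edge set E, and an incidence map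
  ends assigning to every edge its set of end vertices (one vertex for a loop,
  two for an ordinary edge). Parallel edges and loops are allowed.\<close>

definition graph :: "'v set \<Rightarrow> 'e set \<Rightarrow> ('e \<Rightarrow> 'v set) \<Rightarrow> bool" where
  "graph V E ends \<longleftrightarrow> finite V \<and> finite E \<and>
     (\<forall>e\<in>E. ends e \<subseteq> V \<and> (card (ends e) = 1 \<or> card (ends e) = 2))"

text \<open>C is (the edge set of) a cycle: edges e_0..e_(n-1) pairwise distinct, n \<ge> 1,
  vertices v_0..v_(n-1) pairwise distinct, and e_i joins v_i and v_(i+1 mod n).
  For n = 1 this is a loop, for n = 2 a pair of parallel edges.\<close>

definition is_cycle :: "('e \<Rightarrow> 'v set) \<Rightarrow> 'e set \<Rightarrow> bool" where
  "is_cycle ends C \<longleftrightarrow> (\<exists>vs es. es \<noteq> [] \<and> length vs = length es \<and>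
      distinct vs \<and> distinct es \<and> set es = C \<and>
      (\<forall>i<length es. ends (es ! i) = {vs ! i, vs ! ((i + 1) mod length es)}))"

definition acyclic_edges :: "('e \<Rightarrow> 'v set) \<Rightarrow> 'e set \<Rightarrow> bool" where
  "acyclic_edges ends F \<longleftrightarrow> \<not> (\<exists>C\<subseteq>F. is_cycle ends C)"

definition cm_base :: "'e set \<Rightarrow> ('e \<Rightarrow> 'v set) \<Rightarrow> 'e set \<Rightarrow> bool" where
  "cm_base E ends B \<longleftrightarrow> B \<subseteq> E \<and> acyclic_edges ends B \<and>
     (\<forall>F. B \<subset> F \<and> F \<subseteq> E \<longrightarrow> \<not> acyclic_edges ends F)"

definition cm_rank :: "'e set \<Rightarrow> ('e \<Rightarrow> 'v set) \<Rightarrow> nat" where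
  "cm_rank E ends = Max {card F | F. F \<subseteq> E \<and> acyclic_edges ends F}"

definition kbase_vertices :: "nat \<Rightarrow> 'e set \<Rightarrow> ('e \<Rightarrow> 'v set) \<Rightarrow> 'e set set set" where
  "kbase_vertices k E ends = {\<B>. finite \<B> \<and> card \<B> = k \<and> (\<forall>B\<in>\<B>. cm_base E ends B) \<and>
      (\<forall>B\<in>\<B>. \<forall>D\<in>\<B>. B \<noteq> D \<longrightarrow> B \<inter> D = {})}"

definition kbase_adj :: "nat \<Rightarrow> 'e set \<Rightarrow> ('e \<Rightarrow> 'v set) \<Rightarrow> 'e set set \<Rightarrow> 'e set set \<Rightarrow> bool" where
  "kbase_adj k E ends X Y \<longleftrightarrow> X \<in> kbase_vertices k E ends \<and> Y \<in> kbase_vertices k E ends \<and>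
      X \<noteq> Y \<and> X \<inter> Y \<noteq> {}"

definition kbase_connected :: "nat \<Rightarrow> 'e set \<Rightarrow> ('e \<Rightarrow> 'v set) \<Rightarrow> bool" where
  "kbase_connected k E ends \<longleftrightarrow> (\<forall>X\<in>kbase_vertices k E ends. \<forall>Y\<in>kbase_vertices k E ends.
      (kbase_adj k E ends)\<^sup>*\<^sup>* X Y)"

end

theory Submission
  imports Defs
begin

text \<open>
  After gluing the components of the graph at a vertex, the bases are the spanning trees of a
  connected graph, and partitions into \<open>k\<close> of them become colorings of the \<open>k (|V| - 1)\<close> edges in
  which every color class is connected. Two colorings are adjacent if they share a color class;
  recoloring only two classes is such a step because \<open>k \<ge> 3\<close>.

  We induct on the number of vertices. Some vertex \<open>v\<close> has degree less than \<open>2k\<close>, and symmetric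
  exchanges lead to a coloring that uses each color once or twice at \<open>v\<close>. The colors used twice
  form a set \<open>P\<close> of pairs of edges at \<open>v\<close>. Deleting \<open>v\<close> and replacing each pair in \<open>P\<close> by one edge
  between the far ends yields a smaller graph; walks between its colorings lift, so all
  colorings with the same \<open>P\<close> are linked. For different \<open>P\<close>, an exchange turns a pair \<open>{a, b}\<close> into
  \<open>{a, x}\<close> or \<open>{b, x}\<close> for any other edge \<open>x\<close> at \<open>v\<close>, and keeps the pairs that meet neither \<open>{a, b}\<close>
  nor \<open>x\<close>. Choose colorings from two classes of linked colorings such that their sets of pairs
  have as many pairs in common as possible. If the sets differ, the remaining pairs available
  to either class form a complete multipartite graph on the same set of edges at \<open>v\<close>; two such
  graphs share an edge, which contradicts the choice.
\<close>

section \<open>Connectivity of edge sets\<close>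

definition conn :: "('e \<Rightarrow> 'v set) \<Rightarrow> 'e set \<Rightarrow> 'v \<Rightarrow> 'v \<Rightarrow> bool" where
  "conn ends F = (\<lambda>x y. \<exists>e\<in>F. ends e = {x, y})\<^sup>*\<^sup>*"

definition spans :: "('e \<Rightarrow> 'v set) \<Rightarrow> 'e set \<Rightarrow> 'v set \<Rightarrow> bool" where
  "spans ends F W \<longleftrightarrow> (\<forall>x\<in>W. \<forall>y\<in>W. conn ends F x y)"

definition separated :: "('e \<Rightarrow> 'v set) \<Rightarrow> 'e set \<Rightarrow> 'v set \<Rightarrow> bool" where
  "separated ends F I \<longleftrightarrow> (\<forall>x\<in>I. \<forall>y\<in>I. conn ends F x y \<longrightarrow> x = y)"

lemma conn_refl [simp, intro]: "conn ends F x x"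
  by (simp add: conn_def)

lemma conn_edge: "e \<in> F \<Longrightarrow> ends e = {x, y} \<Longrightarrow> conn ends F x y"
  unfolding conn_def by (rule r_into_rtranclp) blast

lemma conn_trans [trans]: "conn ends F x y \<Longrightarrow> conn ends F y z \<Longrightarrow> conn ends F x z"
  unfolding conn_def by (rule rtranclp_trans)

lemma conn_sym: "conn ends F x y \<Longrightarrow> conn ends F y x"
  unfolding conn_def
proof (induction rule: rtranclp_induct)
  case (step y z)
  then have "(\<lambda>x y. \<exists>e\<in>F. ends e = {x, y}) z y"
    by (auto simp: insert_commute)
  then show ?case using step.IH by (rule converse_rtranclp_into_rtranclp)
qed simp

lemma conn_induct [consumes 1, case_names refl step]:
  assumes "conn ends F a b" and "P a"
    and "\<And>y z e. conn ends F a y \<Longrightarrow> e \<in> F \<Longrightarrow> ends e = {y, z} \<Longrightarrow> P y \<Longrightarrow> P z"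
  shows "P b"
  using assms(1) unfolding conn_def
  by (induction rule: rtranclp_induct) (use assms(2,3) in \<open>auto simp: conn_def\<close>)

lemma conn_lift:
  assumes "conn ends F a b"
    and "\<And>e x y. e \<in> F \<Longrightarrow> ends e = {x, y} \<Longrightarrow> conn ends' G x y"
  shows "conn ends' G a b"
  using assms(1) by (induction rule: conn_induct) (use assms(2) in \<open>auto intro: conn_trans\<close>)

lemma conn_mono: "conn ends F x y \<Longrightarrow> F \<subseteq> G \<Longrightarrow> conn ends G x y"
  by (erule conn_lift) (auto intro: conn_edge)

text \<open>A walk can be shortened until it uses \<open>e\<close> at most once, in one of the two
  directions.\<close>

lemma conn_insert:
  assumes "conn ends (insert e F) x y" and e: "ends e = {a, b}"
  shows "conn ends F x y \<or> conn ends F x a \<and> conn ends F b y \<or> conn ends F x b \<and> conn ends F a y"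
  using assms(1)
proof (induction rule: conn_induct)
  case (step y z e')
  show ?case
  proof (cases "e' \<in> F")
    case True
    then have "conn ends F y z" using step by (auto intro: conn_edge)
    then show ?thesis using step.IH conn_trans by metis
  next
    case False
    then have "{y, z} = {a, b}" using step e by auto
    then show ?thesis using step.IH conn_trans conn_refl by (metis doubleton_eq_iff)
  qed
qed simp

text \<open>A new edge merges at most two components, so at most one vertex has to be given up for
  each edge of \<open>N\<close>.\<close>

lemma separated_after_adding_edges:
  assumes "finite N" "finite I" "separated ends F I" "\<And>e. e \<in> N \<Longrightarrow> \<exists>x y. ends e = {x, y}"
  shows "\<exists>J\<subseteq>I. separated ends (F \<union> N) J \<and> card I \<le> card J + card N"
  using assms(1,4)
proof (induction N rule: finite_induct)
  case empty
  then show ?case using assms by auto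
next
  case (insert e N)
  then obtain J where J: "J \<subseteq> I" "separated ends (F \<union> N) J" "card I \<le> card J + card N"
    by auto
  obtain a b where ab: "ends e = {a, b}" using insert.prems by blast
  \<comment> \<open>At most one vertex of \<open>J\<close> reaches \<open>a\<close>. Without it, no
    path between two remaining vertices can pass through \<open>e\<close>, since one part of the
    path would lead to \<open>a\<close>.\<close>
  let ?K = "{x\<in>J. \<not> conn ends (F \<union> N) x a}"
  have fJ: "finite J" using J(1) assms(2) finite_subset by blast
  have "x = y" if "x \<in> J - ?K" "y \<in> J - ?K" for x y
  proof -
    have "conn ends (F \<union> N) x y" using that conn_sym conn_trans by (metis (lifting) Diff_iff mem_Collect_eq)
    then show ?thesis using that J(2) unfolding separated_def by blast
  qed
  then have "card (J - ?K) \<le> Suc 0"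
    using fJ by (subst card_le_Suc0_iff_eq) auto
  moreover have "card J = card ?K + card (J - ?K)"
    using fJ by (subst card_Un_disjoint[symmetric]) (auto intro!: arg_cong[where f = card])
  moreover have "separated ends (insert e (F \<union> N)) ?K"
    unfolding separated_def
  proof (intro ballI impI)
    fix x y assume xy: "x \<in> ?K" "y \<in> ?K" "conn ends (insert e (F \<union> N)) x y"
    then have "conn ends (F \<union> N) x y"
      using conn_insert[of ends e "F \<union> N" x y a b] ab by (auto dest: conn_sym)
    then show "x = y" using xy J(2) unfolding separated_def by blast
  qed
  ultimately show ?case using J insert.hyps by (intro exI[of _ ?K]) auto
qed

text \<open>Once all of \<open>N\<close> is added, at most one vertex of \<open>I\<close> can still
  be kept; joining \<open>card I\<close> components therefore costs at least
  \<open>card I - 1\<close> edges.\<close>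

lemma card_separated_le:
  assumes "finite N" "finite I" "separated ends F I" "spans ends (F \<union> N) I"
    and "\<And>e. e \<in> N \<Longrightarrow> \<exists>x y. ends e = {x, y}"
  shows "card I \<le> card N + 1"
proof -
  obtain J where J: "J \<subseteq> I" "separated ends (F \<union> N) J" "card I \<le> card J + card N"
    using separated_after_adding_edges[of N I ends F] assms by auto
  have "x = y" if "x \<in> J" "y \<in> J" for x y
    using that J assms(4) unfolding spans_def separated_def by blast
  then have "card J \<le> 1"
    by (metis One_nat_def card_le_Suc0_iff_eq finite_subset[OF J(1) assms(2)])
  then show ?thesis using J by simp
qed

lemma card_le_if_spans:
  assumes "finite F" "finite W" "spans ends F W" "\<And>e. e \<in> F \<Longrightarrow> \<exists>x y. ends e = {x, y}"
  shows "card W \<le> card F + 1"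
proof -
  have "x = y" if "conn ends {} x y" for x y
    using that by (induction rule: conn_induct) auto
  then show ?thesis
    using card_separated_le[of F W ends "{}"] assms by (auto simp: separated_def)
qed

lemma spans_subset: "spans ends F W \<Longrightarrow> W' \<subseteq> W \<Longrightarrow> spans ends F W'"
  unfolding spans_def by blast

lemma spansI_root: "(\<And>x. x \<in> W \<Longrightarrow> conn ends F x r) \<Longrightarrow> spans ends F W"
  unfolding spans_def by (meson conn_sym conn_trans)

text \<open>The edge \<open>f\<close> is taken from a minimal set of edges of \<open>B\<close> connecting the ends of \<open>e\<close>.\<close>

lemma tree_exchange:
  assumes "finite B" "spans ends B W" "spans ends (insert e A) W" "ends e = {x, y}" "x \<in> W" "y \<in> W"
    and cut: "\<not> conn ends A x y" and inW: "\<And>f. f \<in> B \<Longrightarrow> \<exists>p\<in>W. \<exists>q\<in>W. ends f = {p, q}"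
  shows "\<exists>f\<in>B. (\<forall>p q. ends f = {p, q} \<longrightarrow> \<not> conn ends A p q) \<and>
    spans ends (insert f A) W \<and> spans ends (insert e (B - {f})) W"
proof -
  define \<P> where "\<P> = {Q. Q \<subseteq> B \<and> conn ends Q x y}"
  have "finite \<P>" "\<P> \<noteq> {}"
    using assms unfolding \<P>_def spans_def by auto
  then obtain Q where Q: "Q \<in> \<P>" "\<And>R. R \<in> \<P> \<Longrightarrow> R \<subseteq> Q \<Longrightarrow> Q = R"
    using finite_has_minimal[of \<P>] by blast
  \<comment> \<open>The path \<open>Q\<close> from \<open>x\<close> to \<open>y\<close> must pass
    between components of \<open>A\<close>; an edge where it does so is exchanged for
    \<open>e\<close>.\<close>
  have "\<exists>f\<in>Q. \<exists>p q. ends f = {p, q} \<and> \<not> conn ends A p q"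
  proof (rule ccontr)
    assume "\<not> ?thesis"
    then have "conn ends A x y"
      using conn_lift[of ends Q x y ends A] Q(1) unfolding \<P>_def by blast
    then show False using cut by simp
  qed
  then obtain f p q where f: "f \<in> Q" "ends f = {p, q}" "\<not> conn ends A p q" by blast
  have fB: "f \<in> B" using f Q unfolding \<P>_def by auto
  have pq: "p \<in> W" "q \<in> W" using inW[OF fB] f by (auto simp: doubleton_eq_iff)
  \<comment> \<open>By minimality \<open>f\<close> separates \<open>x\<close> from \<open>y\<close>
    in \<open>Q\<close>, so the rest of \<open>Q\<close> together with \<open>e\<close> leads around
    \<open>f\<close>.\<close>
  have "Q - {f} \<notin> \<P>" using Q(2)[of "Q - {f}"] f(1) by blast
  then have "\<not> conn ends (Q - {f}) x y"
    using Q(1) unfolding \<P>_def by blast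
  moreover have "conn ends (insert f (Q - {f})) x y"
    using Q f unfolding \<P>_def by (simp add: insert_absorb)
  ultimately have "conn ends (Q - {f}) x p \<and> conn ends (Q - {f}) q y \<or>
     conn ends (Q - {f}) x q \<and> conn ends (Q - {f}) p y"
    using conn_insert[of ends f "Q - {f}" x y p q] f(2) by blast
  moreover have "Q - {f} \<subseteq> insert e (B - {f})" using Q unfolding \<P>_def by auto
  ultimately have "conn ends (insert e (B - {f})) x p \<and> conn ends (insert e (B - {f})) q y \<or>
     conn ends (insert e (B - {f})) x q \<and> conn ends (insert e (B - {f})) p y"
    by (meson conn_mono)
  moreover have "conn ends (insert e (B - {f})) x y" using assms(4) by (auto intro: conn_edge)
  ultimately have c: "conn ends (insert e (B - {f})) p q"
    by (meson conn_sym conn_trans)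
  have "conn ends (insert e (B - {f})) s t" if "conn ends B s t" for s t
    using that
  proof (rule conn_lift)
    fix g s t assume g: "g \<in> B" "ends g = {s, t}"
    show "conn ends (insert e (B - {f})) s t"
    proof (cases "g = f")
      case True
      then show ?thesis using g f c by (metis conn_sym doubleton_eq_iff)
    qed (use g in \<open>auto intro: conn_edge\<close>)
  qed
  then have s2: "spans ends (insert e (B - {f})) W"
    using assms(2) unfolding spans_def by blast
  \<comment> \<open>On \<open>W\<close>, \<open>A\<close> has at most the two components of
    \<open>x\<close> and \<open>y\<close>; since \<open>f\<close> lies inside neither, it joins
    them.\<close>
  have side: "conn ends A s x \<or> conn ends A s y" if "s \<in> W" for s
    using conn_insert[of ends e A s x x y] assms that unfolding spans_def by blast
  have "conn ends (insert f A) p q" using f by (auto intro: conn_edge)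
  moreover have "conn ends A p x \<and> conn ends A q y \<or> conn ends A p y \<and> conn ends A q x"
    using side[OF pq(1)] side[OF pq(2)] f(3) by (meson conn_sym conn_trans)
  then have "conn ends (insert f A) p x \<and> conn ends (insert f A) q y \<or>
      conn ends (insert f A) p y \<and> conn ends (insert f A) q x"
    by (meson conn_mono subset_insertI)
  ultimately have xy: "conn ends (insert f A) y x" by (meson conn_sym conn_trans)
  have s1: "spans ends (insert f A) W"
  proof (rule spansI_root[where r = x])
    fix s assume "s \<in> W"
    then show "conn ends (insert f A) s x"
      using side xy by (meson conn_mono subset_insertI conn_trans)
  qed
  have "\<not> conn ends A p' q'" if "ends f = {p', q'}" for p' q'
    using that f by (metis conn_sym doubleton_eq_iff)
  then show ?thesis using s1 s2 fB by blast
qed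

section \<open>Colorings with connected color classes\<close>

text \<open>Only connectivity is asked of a class; the edge count in \<open>tree_packing\<close>
  then makes it a spanning tree.\<close>

definition tree_coloring :: "'v set \<Rightarrow> 'e set \<Rightarrow> ('e \<Rightarrow> 'v set) \<Rightarrow> nat \<Rightarrow> ('e \<Rightarrow> nat) \<Rightarrow> bool" where
  "tree_coloring V E ends k c \<longleftrightarrow>
     (\<forall>e\<in>E. c e < k) \<and> (\<forall>i<k. spans ends {e \<in> E. c e = i} V)"

text \<open>The shared class carries the same color on both sides. When colors are forgotten, a step
  becomes an edge of the base graph or stays at one vertex.\<close>

definition coloring_step ::
    "'v set \<Rightarrow> 'e set \<Rightarrow> ('e \<Rightarrow> 'v set) \<Rightarrow> nat \<Rightarrow> ('e \<Rightarrow> nat) \<Rightarrow> ('e \<Rightarrow> nat) \<Rightarrow> bool" where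
  "coloring_step V E ends k c d \<longleftrightarrow>
     tree_coloring V E ends k c \<and> tree_coloring V E ends k d \<and>
     (\<exists>i<k. {e \<in> E. c e = i} = {e \<in> E. d e = i})"

lemma card_eq_sum_color_classes:
  assumes "finite S" "\<And>e. e \<in> S \<Longrightarrow> c e < (k::nat)"
  shows "card S = (\<Sum>i<k. card {e \<in> S. c e = i})"
proof -
  have "S = (\<Union>i<k. {e \<in> S. c e = i})" using assms by auto
  then have "card S = card (\<Union>i<k. {e \<in> S. c e = i})" by simp
  also have "\<dots> = (\<Sum>i<k. card {e \<in> S. c e = i})"
    using assms by (intro card_UN_disjoint) auto
  finally show ?thesis .
qed

locale tree_packing =
  fixes V :: "'v set" and E :: "'e set" and ends :: "'e \<Rightarrow> 'v set" and k :: nat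
  assumes finV: "finite V" and finE: "finite E" and V_ne: "V \<noteq> {}"
    and ends_in: "e \<in> E \<Longrightarrow> \<exists>x\<in>V. \<exists>y\<in>V. ends e = {x, y}"
    and cardE: "card E = k * (card V - 1)" and k3: "3 \<le> k"
begin

abbreviation "col \<equiv> tree_coloring V E ends k"
abbreviation "step \<equiv> coloring_step V E ends k"
abbreviation "linked \<equiv> step\<^sup>*\<^sup>*"

lemma step_sym: "step c d \<Longrightarrow> step d c"
  unfolding coloring_step_def by fastforce

lemma linked_sym: "linked c d \<Longrightarrow> linked d c"
proof (induction rule: rtranclp_induct)
  case (step y z)
  then show ?case using step_sym by (meson converse_rtranclp_into_rtranclp)
qed simp

text \<open>A connected class has at least \<open>card V - 1\<close> edges, and these
  \<open>k\<close> lower bounds already add up to \<open>card E\<close>.\<close>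

lemma card_class:
  assumes "col c" "i < k"
  shows "card {e \<in> E. c e = i} = card V - 1"
proof -
  have ge: "card V - 1 \<le> card {e \<in> E. c e = i}" if "i < k" for i
    using card_le_if_spans[of "{e \<in> E. c e = i}" V ends] assms(1) that finE finV ends_in
    unfolding tree_coloring_def by fastforce
  have "(\<Sum>i<k. card {e \<in> E. c e = i}) = (\<Sum>i<k. card V - 1)"
    using card_eq_sum_color_classes[of E c k] finE assms(1) cardE unfolding tree_coloring_def by simp
  then have "card V - 1 = card {e \<in> E. c e = i}"
    using sum_mono_inv[of "\<lambda>_. card V - 1" "{..<k}" "\<lambda>i. card {e \<in> E. c e = i}" i] ge assms(2) by simp
  then show ?thesis by simp
qed

text \<open>Otherwise the class would still span after losing \<open>e\<close>, with one edge too
  few.\<close>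

lemma class_cut:
  assumes "col c" "e \<in> E" "ends e = {x, y}"
  shows "\<not> conn ends ({f \<in> E. c f = c e} - {e}) x y"
proof
  let ?A = "{f \<in> E. c f = c e}"
  assume *: "conn ends (?A - {e}) x y"
  have i: "c e < k" using assms unfolding tree_coloring_def by blast
  have "conn ends (?A - {e}) s t" if "conn ends ?A s t" for s t
    using that
  proof (rule conn_lift)
    fix g s t assume g: "g \<in> ?A" "ends g = {s, t}"
    show "conn ends (?A - {e}) s t"
    proof (cases "g = e")
      case True
      then have "s = x \<and> t = y \<or> s = y \<and> t = x" using g assms(3) by (auto simp: doubleton_eq_iff)
      then show ?thesis using * by (auto intro: conn_sym)
    qed (use g in \<open>auto intro: conn_edge\<close>)
  qed
  then have "spans ends (?A - {e}) V"
    using assms(1) i unfolding tree_coloring_def spans_def by blast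
  then have "card V \<le> card (?A - {e}) + 1"
    using finV finE ends_in by (intro card_le_if_spans) fastforce+
  moreover have "card (?A - {e}) = card ?A - 1" "card ?A > 0"
    using assms(2) finE by (auto simp: card_gt_0_iff)
  ultimately show False using card_class[OF assms(1) i] by simp
qed

text \<open>As \<open>k\<close> is at least 3, there is a third color, and its class is the same in
  both colorings.\<close>

lemma step_if_two_colors:
  assumes "col c" "col d" "\<And>e. e \<in> E \<Longrightarrow> c e = d e \<or> {c e, d e} \<subseteq> {i, j}"
  shows "step c d"
proof -
  have "\<exists>l<3. l \<noteq> i \<and> l \<noteq> j" by presburger
  then obtain l where l: "l < k" "l \<noteq> i" "l \<noteq> j" using k3 by (meson less_le_trans)
  then have "{e \<in> E. c e = l} = {e \<in> E. d e = l}" using assms(3) by fastforce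
  then show ?thesis using assms(1,2) l unfolding coloring_step_def by blast
qed

text \<open>Symmetric basis exchange between the trees of colors \<open>i\<close> and
  \<open>j\<close>. That \<open>f\<close> crosses the cut left by \<open>e\<close> is recorded
  because \<open>move_to_leaf_class\<close> locates \<open>f\<close> by it.\<close>

lemma coloring_exchange:
  assumes c: "col c" and e: "e \<in> E" "c e = i" and j: "j < k" "j \<noteq> i"
  shows "\<exists>f\<in>E. c f = j \<and> (\<forall>p q. ends f = {p, q} \<longrightarrow> \<not> conn ends ({g \<in> E. c g = i} - {e}) p q) \<and>
     step c (c(e := j, f := i))"
proof -
  obtain x y where xy: "x \<in> V" "y \<in> V" "ends e = {x, y}" using ends_in e(1) by blast
  let ?A = "{g \<in> E. c g = i} - {e}" and ?B = "{g \<in> E. c g = j}"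
  have i: "i < k" using c e unfolding tree_coloring_def by blast
  have ins: "insert e ?A = {g \<in> E. c g = i}" using e by auto
  have "\<exists>f\<in>?B. (\<forall>p q. ends f = {p, q} \<longrightarrow> \<not> conn ends ?A p q) \<and>
    spans ends (insert f ?A) V \<and> spans ends (insert e (?B - {f})) V"
  proof (rule tree_exchange[where x = x and y = y])
    show "spans ends (insert e ?A) V" unfolding ins using c i by (simp add: tree_coloring_def)
    show "\<not> conn ends ?A x y" using class_cut[OF c e(1) xy(3)] e(2) by simp
  qed (use finE c j xy ends_in in \<open>auto simp: tree_coloring_def\<close>)
  then obtain f where f: "f \<in> ?B" "\<forall>p q. ends f = {p, q} \<longrightarrow> \<not> conn ends ?A p q"
    "spans ends (insert f ?A) V" "spans ends (insert e (?B - {f})) V" by blast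
  let ?d = "c(e := j, f := i)"
  have "spans ends {g \<in> E. ?d g = l} V" if l: "l < k" for l
  proof -
    have "{g \<in> E. ?d g = i} = insert f ?A" "{g \<in> E. ?d g = j} = insert e (?B - {f})"
      "l \<noteq> i \<Longrightarrow> l \<noteq> j \<Longrightarrow> {g \<in> E. ?d g = l} = {g \<in> E. c g = l}"
      using e f(1) j by auto
    then show ?thesis using f c l unfolding tree_coloring_def by metis
  qed
  then have d: "col ?d" using c i j unfolding tree_coloring_def by auto
  have "step c ?d"
    using f(1) e by (intro step_if_two_colors[OF c d, of i j]) auto
  then show ?thesis using f by blast
qed

end

section \<open>Exchanges at a vertex of low degree\<close>

locale packing_at_vertex = tree_packing V E ends k
  for V :: "'v set" and E :: "'e set" and ends :: "'e \<Rightarrow> 'v set" and k :: nat +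
  fixes v :: 'v
  assumes vV: "v \<in> V" and V2: "2 \<le> card V"
    and no_loop: "e \<in> E \<Longrightarrow> ends e \<noteq> {v}"
    and low_degree: "card {e \<in> E. v \<in> ends e} < 2 * k"
begin

section \<open>The edges at \<open>v\<close> and the color classes seen from
  \<open>v\<close>\<close>

definition star :: "'e set" where "star = {e \<in> E. v \<in> ends e}"

definition tip :: "'e \<Rightarrow> 'v" where "tip e = (THE x. ends e = {v, x})"

definition star_class :: "('e \<Rightarrow> nat) \<Rightarrow> nat \<Rightarrow> 'e set" where
  "star_class c i = {e \<in> star. c e = i}"

definition far_class :: "('e \<Rightarrow> nat) \<Rightarrow> nat \<Rightarrow> 'e set" where
  "far_class c i = {e \<in> E - star. c e = i}"

lemma star_subset: "star \<subseteq> E" and finite_star [simp]: "finite star"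
  using finE by (auto simp: star_def)

lemma ends_star:
  assumes "e \<in> star"
  shows "ends e = {v, tip e}" "tip e \<in> V - {v}"
proof -
  obtain x y where "x \<in> V" "y \<in> V" "ends e = {x, y}" "v \<in> {x, y}"
    using assms ends_in unfolding star_def by blast
  then obtain z where z: "z \<in> V" "ends e = {v, z}" by (auto simp: insert_commute)
  then have "tip e = z" unfolding tip_def by (auto simp: doubleton_eq_iff)
  moreover have "z \<noteq> v" using z no_loop assms star_subset by auto
  ultimately show "ends e = {v, tip e}" "tip e \<in> V - {v}" using z by auto
qed

lemma class_split: "{e \<in> E. c e = i} = far_class c i \<union> star_class c i"
  using star_subset by (auto simp: far_class_def star_class_def)

text \<open>Up to its first visit to \<open>v\<close>, a path from \<open>x\<close> uses edges of
  \<open>F\<close> only, and it enters \<open>v\<close> by an edge of \<open>A\<close>. This turns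
  connectivity into a condition on the graph without \<open>v\<close>.\<close>

lemma spans_star_iff:
  assumes "F \<subseteq> E - star" "A \<subseteq> star"
  shows "spans ends (F \<union> A) V \<longleftrightarrow> (\<forall>x\<in>V - {v}. \<exists>a\<in>A. conn ends F x (tip a))"
proof
  assume sp: "spans ends (F \<union> A) V"
  \<comment> \<open>The witness \<open>a\<close> is the last star edge used by the walk from
    \<open>v\<close> to \<open>z\<close>.\<close>
  have "z \<noteq> v \<longrightarrow> (\<exists>a\<in>A. conn ends F (tip a) z)" if "conn ends (F \<union> A) v z" for z
    using that
  proof (induction rule: conn_induct)
    case (step y z e)
    show ?case
    proof (cases "e \<in> F")
      case True
      then have "y \<noteq> v" using step assms unfolding star_def by auto
      then show ?thesis using step True by (meson conn_edge conn_trans)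
    next
      case False
      then have e: "e \<in> A" "{v, tip e} = {y, z}"
        using step ends_star(1)[of e] assms by auto
      show ?thesis
      proof
        assume "z \<noteq> v"
        then have "z = tip e" using e by (auto simp: doubleton_eq_iff)
        then show "\<exists>a\<in>A. conn ends F (tip a) z" using e by auto
      qed
    qed
  qed simp
  then show "\<forall>x\<in>V - {v}. \<exists>a\<in>A. conn ends F x (tip a)"
    using sp vV conn_sym[of ends F] unfolding spans_def by blast
next
  assume *: "\<forall>x\<in>V - {v}. \<exists>a\<in>A. conn ends F x (tip a)"
  show "spans ends (F \<union> A) V"
  proof (rule spansI_root[where r = v])
    fix x assume x: "x \<in> V"
    show "conn ends (F \<union> A) x v"
    proof (cases "x = v")
      case False
      then obtain a where a: "a \<in> A" "conn ends F x (tip a)" using * x by auto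
      then have "conn ends (F \<union> A) x (tip a)" by (auto intro: conn_mono)
      moreover have "conn ends (F \<union> A) v (tip a)"
        using a assms ends_star(1)[of a] by (intro conn_edge[of a]) auto
      ultimately show ?thesis by (meson conn_sym conn_trans)
    qed simp
  qed
qed

lemma spans_class_iff:
  "spans ends {e \<in> E. c e = i} V \<longleftrightarrow>
     (\<forall>x\<in>V - {v}. \<exists>a\<in>star_class c i. conn ends (far_class c i) x (tip a))"
  unfolding class_split by (rule spans_star_iff) (auto simp: far_class_def star_class_def)

lemma far_reaches_star:
  assumes "col c" "i < k" "x \<in> V - {v}"
  shows "\<exists>a\<in>star_class c i. conn ends (far_class c i) x (tip a)"
  using assms spans_class_iff[of c i] unfolding tree_coloring_def by blast

lemma V_minus_v_ne: "V - {v} \<noteq> {}"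
proof
  assume "V - {v} = {}"
  then have "card V \<le> card {v}" by (intro card_mono) auto
  then show False using V2 by simp
qed

lemma star_class_ne: "col c \<Longrightarrow> i < k \<Longrightarrow> star_class c i \<noteq> {}"
  using far_reaches_star V_minus_v_ne by blast

lemma finite_star_class [simp]: "finite (star_class c i)"
  by (simp add: star_class_def)

lemma card_star_class_pos: "col c \<Longrightarrow> i < k \<Longrightarrow> 1 \<le> card (star_class c i)"
  using star_class_ne by (simp add: Suc_le_eq card_gt_0_iff)

text \<open>Otherwise \<open>a\<close>, \<open>b\<close> and a path between their tips would close a
  cycle in the class. So the star edges of one color lead to different components of its far
  class.\<close>

lemma tips_separated:
  assumes c: "col c" and ab: "a \<in> star_class c i" "b \<in> star_class c i" "a \<noteq> b"
  shows "\<not> conn ends (far_class c i) (tip a) (tip b)"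
proof
  assume *: "conn ends (far_class c i) (tip a) (tip b)"
  let ?A = "{e \<in> E. c e = i} - {a}"
  have a: "a \<in> star" "b \<in> star" "c a = i" "c b = i" using ab by (auto simp: star_class_def)
  have "far_class c i \<subseteq> ?A" using a by (auto simp: far_class_def)
  then have "conn ends ?A (tip a) (tip b)" using * by (rule conn_mono[rotated])
  moreover have "conn ends ?A v (tip b)"
    using a ab star_subset ends_star(1)[of b] by (intro conn_edge[of b]) auto
  ultimately have "conn ends ?A v (tip a)" by (meson conn_sym conn_trans)
  then show False using class_cut[OF c, of a v "tip a"] a star_subset ends_star(1)[of a] by auto
qed

text \<open>In color \<open>j\<close> the vertex \<open>v\<close> is a leaf. The edge
  \<open>f\<close> exchanged for \<open>e\<close> is not \<open>g\<close>: class \<open>i\<close>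
  without \<open>e\<close> still joins \<open>tip g\<close> to \<open>v\<close> through another star
  edge \<open>a\<close>, whereas \<open>f\<close> crosses the cut. So \<open>f\<close> avoids the
  star, where only \<open>e\<close> changes its color.\<close>

lemma move_to_leaf_class:
  assumes c: "col c" and j: "j < k" "j \<noteq> i" "star_class c j = {g}"
    and e: "e \<in> star_class c i" and ng: "\<not> conn ends (far_class c i) (tip g) (tip e)"
  shows "\<exists>d. step c d \<and> (\<forall>x\<in>star. d x = (c(e := j)) x)"
proof -
  have e': "e \<in> star" "e \<in> E" "c e = i" using e star_subset by (auto simp: star_class_def)
  have i: "i < k" using c e' unfolding tree_coloring_def by blast
  obtain f where f: "f \<in> E" "c f = j" 
      "\<forall>p q. ends f = {p, q} \<longrightarrow> \<not> conn ends ({g \<in> E. c g = i} - {e}) p q"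
      "step c (c(e := j, f := i))"
    using coloring_exchange[OF c e'(2,3) j(1,2)] by blast
  have "f \<notin> star"
  proof
    assume "f \<in> star"
    then have "f = g" using f(2) j(3) by (auto simp: star_class_def)
    with \<open>f \<in> star\<close> have g: "ends f = {v, tip g}" "tip g \<in> V - {v}"
      using ends_star by auto
    obtain a where a: "a \<in> star_class c i" "conn ends (far_class c i) (tip g) (tip a)"
      using far_reaches_star[OF c i g(2)] by blast
    have "a \<noteq> e" using a ng by auto
    then have a': "a \<in> {g \<in> E. c g = i} - {e}" "ends a = {v, tip a}"
      using a star_subset ends_star(1)[of a] by (auto simp: star_class_def)
    have "conn ends ({g \<in> E. c g = i} - {e}) (tip g) (tip a)"
      using a(2) by (rule conn_mono) (use e' in \<open>auto simp: far_class_def\<close>)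
    then have "conn ends ({g \<in> E. c g = i} - {e}) v (tip g)"
      using conn_edge[of a "{g \<in> E. c g = i} - {e}" ends v "tip a"] a'
      by (meson conn_sym conn_trans)
    then show False using f(3) g(1) by blast
  qed
  then show ?thesis using f(4) by (intro exI[of _ "c(e := j, f := i)"]) auto
qed

text \<open>The tips of \<open>a\<close> and \<open>b\<close> lie in different components of the far
  class, so \<open>tip g\<close> is connected to at most one of them.\<close>

lemma move_one_of_two:
  assumes c: "col c" and j: "j < k" "j \<noteq> i" "star_class c j = {g}"
    and ab: "a \<in> star_class c i" "b \<in> star_class c i" "a \<noteq> b"
  shows "\<exists>e\<in>{a, b}. \<exists>d. step c d \<and> (\<forall>x\<in>star. d x = (c(e := j)) x)"
proof -
  have "\<not> conn ends (far_class c i) (tip g) (tip a) \<or> \<not> conn ends (far_class c i) (tip g) (tip b)"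
    using tips_separated[OF c ab] by (meson conn_sym conn_trans)
  then show ?thesis using move_to_leaf_class[OF c j] ab by blast
qed

section \<open>Balanced colorings and their pairs\<close>

definition balanced :: "('e \<Rightarrow> nat) \<Rightarrow> bool" where
  "balanced c \<longleftrightarrow> col c \<and> (\<forall>i<k. card (star_class c i) \<le> 2)"

text \<open>Pairs are recorded without their colors, because the graph obtained by splitting off
  depends on the pairs alone.\<close>

definition star_pairs :: "('e \<Rightarrow> nat) \<Rightarrow> 'e set set" where
  "star_pairs c = star_class c ` {i. i < k \<and> card (star_class c i) = 2}"

lemma card_star: "col c \<Longrightarrow> card star = (\<Sum>i<k. card (star_class c i))"
  unfolding star_class_def using star_subset
  by (intro card_eq_sum_color_classes) (auto simp: tree_coloring_def)

lemma star_class_move: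
  assumes "\<forall>x\<in>star. d x = (c(e := j)) x" "e \<in> star_class c i" "i \<noteq> j"
  shows "star_class d i = star_class c i - {e}" "star_class d j = insert e (star_class c j)"
    "l \<noteq> i \<Longrightarrow> l \<noteq> j \<Longrightarrow> star_class d l = star_class c l"
  using assms by (auto simp: star_class_def split: if_splits)

text \<open>Induction on the number of colors used once at \<open>v\<close>. If some color
  \<open>i\<close> is used three times or more, the degree bound provides such a color
  \<open>j\<close>. Moving a star edge from \<open>i\<close> to \<open>j\<close> removes
  \<open>j\<close> from the count and adds no color, since \<open>i\<close> keeps at least two
  edges.\<close>

lemma linked_to_balanced:
  assumes "col c"
  shows "\<exists>d. linked c d \<and> balanced d"
  using assms
proof (induction "card {i. i < k \<and> card (star_class c i) = 1}" arbitrary: c rule: less_induct)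
  case less
  show ?case
  proof (cases "balanced c")
    case False
    then obtain i where i: "i < k" "3 \<le> card (star_class c i)"
      using less.prems unfolding balanced_def by (auto simp: not_le)
    have "\<exists>j<k. card (star_class c j) < 2"
    proof (rule ccontr)
      assume "\<not> ?thesis"
      then have "(\<Sum>i<k. 2) \<le> (\<Sum>i<k. card (star_class c i))" by (intro sum_mono) auto
      then show False using card_star[OF less.prems] low_degree unfolding star_def by simp
    qed
    then obtain j where j: "j < k" "card (star_class c j) < 2" by blast
    then have j: "j < k" "card (star_class c j) = 1"
      using card_star_class_pos[OF less.prems, of j] by auto
    then obtain g where g: "star_class c j = {g}" using card_1_singletonE by blast
    obtain a b where ab: "a \<in> star_class c i" "b \<in> star_class c i" "a \<noteq> b"
      using i(2) by (metis One_nat_def card_le_Suc0_iff_eq finite_star_class not_less_eq_eq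
          numeral_3_eq_3 le_SucI)
    have ij: "j \<noteq> i" using i j by auto
    obtain e d where d: "e \<in> star_class c i" "step c d" "\<forall>x\<in>star. d x = (c(e := j)) x"
      using move_one_of_two[OF less.prems j(1) ij g ab] ab by blast
    note m = star_class_move[OF d(3,1) ij[symmetric]]
    have "e \<notin> star_class c j" using d(1) ij by (auto simp: star_class_def)
    then have cj: "card (star_class d j) = 2" using m(2) j by simp
    have ci: "card (star_class d i) \<ge> 2" using m(1) d(1) i(2) by simp
    have "{i. i < k \<and> card (star_class d i) = 1} \<subset> {i. i < k \<and> card (star_class c i) = 1}"
    proof
      show "{i. i < k \<and> card (star_class d i) = 1} \<subseteq> {i. i < k \<and> card (star_class c i) = 1}"
      proof
        fix l assume l: "l \<in> {i. i < k \<and> card (star_class d i) = 1}"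
        then have "l \<noteq> i" "l \<noteq> j" using ci cj by auto
        then show "l \<in> {i. i < k \<and> card (star_class c i) = 1}" using l m(3) by auto
      qed
      have "j \<in> {i. i < k \<and> card (star_class c i) = 1}" "j \<notin> {i. i < k \<and> card (star_class d i) = 1}"
        using j cj by auto
      then show "{i. i < k \<and> card (star_class d i) = 1} \<noteq> {i. i < k \<and> card (star_class c i) = 1}"
        by blast
    qed
    then have "card {i. i < k \<and> card (star_class d i) = 1} < card {i. i < k \<and> card (star_class c i) = 1}"
      by (intro psubset_card_mono) auto
    then obtain d' where "linked d d'" "balanced d'"
      using less.hyps d(2) unfolding coloring_step_def by blast
    then show ?thesis using d(2) by (meson converse_rtranclp_into_rtranclp)
  qed blast
qed

lemma star_class_disjoint: "i \<noteq> j \<Longrightarrow> star_class c i \<inter> star_class c j = {}"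
  by (auto simp: star_class_def)

lemma star_pairs_disjoint:
  assumes "p \<in> star_pairs c" "q \<in> star_pairs c" "x \<in> p" "x \<in> q"
  shows "p = q"
  using assms by (auto simp: star_pairs_def star_class_def)

lemma finite_star_pairs [simp]: "finite (star_pairs c)"
  by (simp add: star_pairs_def)

text \<open>Each color accounts for one star edge and each pair for one more. Hence all balanced
  colorings have equally many pairs.\<close>

lemma card_star_pairs:
  assumes "balanced c"
  shows "card star = k + card (star_pairs c)"
proof -
  let ?I = "{i. i < k \<and> card (star_class c i) = 2}"
  have c: "col c" using assms by (simp add: balanced_def)
  have "inj_on (star_class c) ?I"
  proof (rule inj_onI)
    fix i j assume ij: "i \<in> ?I" "j \<in> ?I" "star_class c i = star_class c j"
    then have "star_class c i \<inter> star_class c j \<noteq> {}" using star_class_ne[OF c] by auto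
    then show "i = j" using star_class_disjoint by blast
  qed
  then have "card (star_pairs c) = card ?I" unfolding star_pairs_def by (rule card_image)
  also have "?I = {i \<in> {..<k}. card (star_class c i) = 2}" by auto
  also have "card \<dots> = (\<Sum>i<k. if card (star_class c i) = 2 then 1 else 0)"
    unfolding card_eq_sum by (rule sum.inter_filter) simp
  finally have "k + card (star_pairs c) = (\<Sum>i<k. 1 + (if card (star_class c i) = 2 then 1 else 0))"
    by (simp only: sum.distrib) simp
  also have "\<dots> = (\<Sum>i<k. card (star_class c i))"
  proof (rule sum.cong[OF refl])
    fix i assume "i \<in> {..<k}"
    then have "1 \<le> card (star_class c i)" "card (star_class c i) \<le> 2"
      using card_star_class_pos[OF c] assms by (auto simp: balanced_def)
    then show "1 + (if card (star_class c i) = 2 then 1 else 0) = card (star_class c i)" by auto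
  qed
  finally show ?thesis using card_star[OF c] by simp
qed

text \<open>Only the star edges of colors \<open>i\<close> and \<open>c x\<close> are redistributed,
  so pairs of other colors survive.\<close>

lemma pair_exchange:
  assumes bal: "balanced c" and i: "i < k" "star_class c i = {a, b}" "a \<noteq> b"
    and x: "x \<in> star" "x \<noteq> a" "x \<noteq> b"
  shows "\<exists>d. linked c d \<and> balanced d \<and> (\<exists>p\<in>star_pairs d. p = {a, x} \<or> p = {b, x}) \<and>
    (\<forall>l<k. l \<noteq> i \<longrightarrow> l \<noteq> c x \<longrightarrow> star_class d l = star_class c l)"
proof -
  define j where "j = c x"
  have c: "col c" using bal by (simp add: balanced_def)
  have j: "j < k" using c x star_subset unfolding j_def tree_coloring_def by blast
  have xj: "x \<in> star_class c j" using x by (simp add: star_class_def j_def)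
  have ji: "j \<noteq> i" using xj x i by auto
  have fin: ?thesis if "linked c d" "col d" "card (star_class d i) \<le> 2" "card (star_class d j) \<le> 2"
    "\<forall>l<k. l \<noteq> i \<longrightarrow> l \<noteq> j \<longrightarrow> star_class d l = star_class c l"
    "l \<in> {i, j}" "star_class d l = {a, x} \<or> star_class d l = {b, x}" for d l
  proof -
    have "card (star_class d l) = 2" "l < k" using that(6,7) x i j by auto
    then have "star_class d l \<in> star_pairs d" by (simp add: star_pairs_def)
    moreover have "balanced d"
      using that(2-5) bal unfolding balanced_def by metis
    ultimately show ?thesis using that unfolding j_def by blast
  qed
  have card_j: "1 \<le> card (star_class c j)" "card (star_class c j) \<le> 2"
    using card_star_class_pos[OF c j] bal j by (auto simp: balanced_def)
  show ?thesis
  proof (cases "card (star_class c j) = 1")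
    case True
    \<comment> \<open>Here \<open>x\<close> is alone in its color, and \<open>a\<close> or
      \<open>b\<close> can be moved to it.\<close>
    then have g: "star_class c j = {x}" using xj by (metis card_1_singletonE singletonD)
    obtain e d where d: "e \<in> {a, b}" "step c d" "\<forall>y\<in>star. d y = (c(e := j)) y"
      using move_one_of_two[OF c j ji g, of a b] i by auto
    have e: "e \<in> star_class c i" using d i by auto
    note m = star_class_move[OF d(3) e ji[symmetric]]
    show ?thesis
    proof (rule fin[of d j])
      show "card (star_class d i) \<le> 2" using m(1) i by (simp add: card_insert_if card_Diff_singleton_if)
      show "card (star_class d j) \<le> 2" using m(2) g by (simp add: card_insert_if)
      show "linked c d" using d(2) by blast
    qed (use d m g in \<open>auto simp: coloring_step_def\<close>)
  next
    case False
    then have "card (star_class c j - {x}) = 1" using card_j xj by simp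
    then obtain y where "star_class c j - {x} = {y}" using card_1_singletonE by blast
    then have y: "star_class c j = {x, y}" "y \<noteq> x" using xj by auto
    have aE: "a \<in> E" "c a = i" "a \<in> star" using i star_subset by (auto simp: star_class_def)
    have ys: "y \<in> star" "c y = j" using y by (auto simp: star_class_def)
    \<comment> \<open>Here \<open>x\<close> has a partner \<open>y\<close>. Once \<open>a\<close>
      has color \<open>j\<close>, it suffices to separate \<open>x\<close> from \<open>y\<close>:
      moved to color \<open>i\<close>, \<open>x\<close> meets \<open>b\<close>; left in color
      \<open>j\<close>, it meets \<open>a\<close>.\<close>
    obtain f where f: "f \<in> E" "c f = j" "step c (c(a := j, f := i))"
      using coloring_exchange[OF c aE(1,2) j ji] by blast
    let ?d = "c(a := j, f := i)"
    have d: "col ?d" "linked c ?d" using f(3) by (simp_all add: coloring_step_def r_into_rtranclp)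
    have oth: "star_class ?d l = star_class c l" if "l \<noteq> i" "l \<noteq> j" for l
      using that f(2) aE by (auto simp: star_class_def)
    show ?thesis
    proof (cases "f \<in> star")
      case True
      then have "f = x \<or> f = y" using f(2) y(1) by (auto simp: star_class_def)
      then show ?thesis
      proof
        assume "f = x"
        then have "star_class ?d i = {b, x}" "star_class ?d j = {a, y}"
          using i y ji x aE ys by (auto simp: star_class_def)
        then show ?thesis using d oth by (intro fin[of ?d i]) (auto simp: card_insert_if)
      next
        assume "f = y"
        then have "star_class ?d i = {b, y}" "star_class ?d j = {a, x}"
          using i y ji x aE ys by (auto simp: star_class_def)
        then show ?thesis using d oth by (intro fin[of ?d j]) (auto simp: card_insert_if)
      qed
    next
      case False
      \<comment> \<open>No star edge came back, so color \<open>i\<close> holds only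
        \<open>b\<close>. Offering \<open>x\<close> and \<open>y\<close>, but not \<open>a\<close>,
        for the second move keeps the first from being undone.\<close>
      have di: "star_class ?d i = {b}" and dj: "star_class ?d j = {a, x, y}"
        using False i y ji x aE ys f(2) by (auto simp: star_class_def)
      obtain e d2 where d2: "e \<in> {x, y}" "step ?d d2" "\<forall>z\<in>star. d2 z = (?d(e := i)) z"
        using move_one_of_two[OF d(1) i(1) ji[symmetric] di, of x y] dj y by auto
      have e: "e \<in> star_class ?d j" using d2 dj by auto
      note m = star_class_move[OF d2(3) e ji]
      have ay: "a \<noteq> y" using ys aE ji by auto
      have l2: "linked c d2" using d(2) d2(2) by (meson rtranclp.rtrancl_into_rtrancl)
      have "col d2" using d2(2) by (simp add: coloring_step_def)
      note l2 = l2 this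
      show ?thesis
      proof (cases "e = x")
        case True
        then have "star_class d2 i = {b, x}" "star_class d2 j = {a, y}"
          using m(1,2) di dj ay x y by auto
        then show ?thesis using l2 oth m(3) by (intro fin[of d2 i]) (auto simp: card_insert_if)
      next
        case False
        then have "e = y" using d2 by auto
        then have "star_class d2 i = {b, y}" "star_class d2 j = {a, x}"
          using m(1,2) di dj ay x y by auto
        then show ?thesis using l2 oth m(3) by (intro fin[of d2 j]) (auto simp: card_insert_if)
      qed
    qed
  qed
qed

end

section \<open>Splitting off pairs of edges\<close>

text \<open>Serves to hand out leftover star edges to the colors without new edges, with the color
  of one edge prescribed.\<close>

lemma surjection_with_value:
  assumes "finite R" "finite Z" "card Z \<le> card R" "u \<in> R" "j \<in> Z"
  shows "\<exists>g. g ` R = Z \<and> g u = j"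
proof -
  have "card (Z - {j}) \<le> card (R - {u})" using assms by simp
  then obtain T where T: "T \<subseteq> R - {u}" "card T = card (Z - {j})" "finite T"
    using obtain_subset_with_card_n by metis
  then obtain h where h: "bij_betw h T (Z - {j})"
    using finite_same_card_bij[of T "Z - {j}"] assms(2) by auto
  let ?g = "\<lambda>x. if x \<in> T then h x else j"
  have "?g ` R = h ` T \<union> {j}" using T(1) assms(4) by auto
  then have "?g ` R = Z" using h assms(5) unfolding bij_betw_def by auto
  moreover have "?g u = j" using T by auto
  ultimately show ?thesis by blast
qed

text \<open>\<open>name\<close> picks the member of each pair that will stand for the new edge. The
  smaller graph thus has edges of the same type, as the induction on vertices requires.\<close>

locale paired_star = packing_at_vertex V E ends k v
  for V :: "'v set" and E :: "'e set" and ends :: "'e \<Rightarrow> 'v set" and k :: nat and v :: 'v +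
  fixes P :: "'e set set" and name :: "'e set \<Rightarrow> 'e"
  assumes pair_sub: "p \<in> P \<Longrightarrow> p \<subseteq> star" and card_pair: "p \<in> P \<Longrightarrow> card p = 2"
    and pair_disj: "p \<in> P \<Longrightarrow> q \<in> P \<Longrightarrow> x \<in> p \<Longrightarrow> x \<in> q \<Longrightarrow> p = q"
    and card_star_P: "card star = k + card P"
    and name_in: "p \<in> P \<Longrightarrow> name p \<in> p"
begin

definition names :: "'e set" where "names = name ` P"

text \<open>The union has at most one member, since the pairs are disjoint.\<close>

definition pair_of :: "'e \<Rightarrow> 'e set" where "pair_of e = \<Union>{p \<in> P. e \<in> p}"

definition split_edges :: "'e set" where "split_edges = (E - star) \<union> names"

text \<open>Splitting off at \<open>v\<close>: a pair of star edges becomes one edge joining their far ends,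
  and this new edge is denoted by one of the two old ones.\<close>

definition split_ends :: "'e \<Rightarrow> 'v set" where
  "split_ends e = (if e \<in> names then tip ` pair_of e else ends e)"

definition new_class :: "('e \<Rightarrow> nat) \<Rightarrow> nat \<Rightarrow> 'e set" where
  "new_class c i = {e \<in> names. c e = i}"

definition new_star :: "('e \<Rightarrow> nat) \<Rightarrow> nat \<Rightarrow> 'e set" where
  "new_star c i = \<Union>(pair_of ` new_class c i)"

abbreviation "split_col \<equiv> tree_coloring (V - {v}) split_edges split_ends k"
abbreviation "split_step \<equiv> coloring_step (V - {v}) split_edges split_ends k"

lemma finite_P [simp]: "finite P"
  by (rule finite_subset[of _ "Pow star"]) (use pair_sub in auto)

lemma pair_of_eq: "p \<in> P \<Longrightarrow> e \<in> p \<Longrightarrow> pair_of e = p"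
  using pair_disj unfolding pair_of_def by blast

lemma names_in_star: "names \<subseteq> star"
  using pair_sub name_in unfolding names_def by blast

lemma finite_names [simp]: "finite names"
  by (simp add: names_def)

lemma inj_name: "inj_on name P"
  by (rule inj_onI) (metis name_in pair_disj)

lemma card_names: "card names = card P"
  unfolding names_def by (rule card_image[OF inj_name])

lemma pair_of_name:
  assumes "a \<in> names"
  shows "pair_of a \<in> P" "a \<in> pair_of a"
  using assms name_in pair_of_eq unfolding names_def by force+

lemma names_eqI: "a \<in> names \<Longrightarrow> b \<in> names \<Longrightarrow> x \<in> pair_of a \<Longrightarrow> x \<in> pair_of b \<Longrightarrow> a = b"
  unfolding names_def by (metis imageE name_in pair_disj pair_of_eq)

lemma new_star_subset: "new_star c i \<subseteq> star"
  using pair_of_name pair_sub unfolding new_star_def new_class_def by blast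

lemma new_star_disjoint: "i \<noteq> j \<Longrightarrow> new_star c i \<inter> new_star c j = {}"
  using names_eqI unfolding new_star_def new_class_def by blast

lemma finite_new_class [simp]: "finite (new_class c i)"
  by (simp add: new_class_def)

lemma card_P_less: "card P < k"
  using low_degree card_star_P unfolding star_def by simp

lemma split_class: "{e \<in> split_edges. c e = i} = far_class c i \<union> new_class c i"
  by (auto simp: split_edges_def far_class_def new_class_def)

lemma far_new_disjoint: "far_class c i \<inter> new_class c i = {}"
  using names_in_star by (auto simp: far_class_def new_class_def)

lemma finite_far_class [simp]: "finite (far_class c i)"
  using finE by (simp add: far_class_def)

text \<open>The \<open>k + card P\<close> star edges are traded for \<open>card P\<close> new ones,
  so exactly \<open>k\<close> edges are lost along with the vertex \<open>v\<close>.\<close>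

lemma split_packing: "tree_packing (V - {v}) split_edges split_ends k"
proof
  show "finite split_edges" using finE by (simp add: split_edges_def)
  show "\<exists>x\<in>V - {v}. \<exists>y\<in>V - {v}. split_ends e = {x, y}" if "e \<in> split_edges" for e
  proof (cases "e \<in> names")
    case True
    obtain a b where ab: "pair_of e = {a, b}"
      using card_pair[OF pair_of_name(1)[OF True]] by (auto simp: card_2_iff)
    then have "a \<in> star" "b \<in> star" using pair_sub[OF pair_of_name(1)[OF True]] by auto
    then have "tip a \<in> V - {v}" "tip b \<in> V - {v}" "split_ends e = {tip a, tip b}"
      using ab True ends_star by (auto simp: split_ends_def)
    then show ?thesis by blast
  next
    case False
    then have e: "e \<in> E" "v \<notin> ends e" using that by (auto simp: split_edges_def star_def)
    then obtain x y where "x \<in> V" "y \<in> V" "ends e = {x, y}" using ends_in by blast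
    then have "x \<in> V - {v}" "y \<in> V - {v}" "split_ends e = {x, y}"
      using e False by (auto simp: split_ends_def)
    then show ?thesis by blast
  qed
  have "card split_edges = card (E - star) + card names"
    unfolding split_edges_def using names_in_star finE by (intro card_Un_disjoint) auto
  also have "\<dots> = card E - card star + card P"
    using star_subset by (simp add: card_Diff_subset card_names)
  also have "\<dots> = card E - k"
  proof -
    have "card star \<le> card E" using star_subset finE by (rule card_mono[rotated])
    then show ?thesis using card_star_P by simp
  qed
  also have "\<dots> = k * (card (V - {v}) - 1)"
    using cardE vV finV by (simp add: diff_mult_distrib2)
  finally show "card split_edges = k * (card (V - {v}) - 1)" .
qed (use finV V_minus_v_ne k3 in auto)

lemma conn_split_far: "conn split_ends (far_class c i) x y \<longleftrightarrow> conn ends (far_class c i) x y"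
proof -
  have "split_ends e = ends e" if "e \<in> far_class c i" for e
    using that names_in_star by (auto simp: far_class_def split_ends_def)
  then show ?thesis
    using conn_lift[of split_ends "far_class c i" x y ends "far_class c i"]
      conn_lift[of ends "far_class c i" x y split_ends "far_class c i"]
      conn_edge[of _ "far_class c i"] by metis
qed

section \<open>Lifting colorings of the split graph\<close>

lemma card_far_new:
  assumes "split_col c" "i < k"
  shows "card (far_class c i) + card (new_class c i) = card V - 2"
proof -
  interpret S: tree_packing "V - {v}" split_edges split_ends k by (rule split_packing)
  have "card (far_class c i \<union> new_class c i) = card (V - {v}) - 1"
    using S.card_class[OF assms] unfolding split_class .
  then show ?thesis using vV finV far_new_disjoint by (simp add: card_Un_disjoint)
qed

lemma card_far_star:
  assumes "col c" "i < k"
  shows "card (far_class c i) + card (star_class c i) = card V - 1"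
proof -
  have "far_class c i \<inter> star_class c i = {}" by (auto simp: far_class_def star_class_def)
  then show ?thesis using card_class[OF assms] unfolding class_split by (simp add: card_Un_disjoint)
qed

text \<open>On a walk from the tip of a paired edge to \<open>x\<close>, the part after the last new
  edge uses far edges only.\<close>

lemma far_reaches_new_star:
  assumes "split_col c" "i < k" "new_class c i \<noteq> {}" "x \<in> V - {v}"
  shows "\<exists>a\<in>new_star c i. conn ends (far_class c i) x (tip a)"
proof -
  obtain a where a: "a \<in> new_class c i" using assms by blast
  then have a': "a \<in> names" "a \<in> new_star c i" "tip a \<in> V - {v}"
    using pair_of_name names_in_star ends_star(2) by (auto simp: new_star_def new_class_def)
  have "conn split_ends (far_class c i \<union> new_class c i) (tip a) x"
    using assms a'(3) unfolding tree_coloring_def spans_def split_class by blast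
  then have "\<exists>b\<in>new_star c i. conn ends (far_class c i) (tip b) x"
  proof (induction rule: conn_induct)
    case refl
    then show ?case using a' by auto
  next
    case (step y z e)
    show ?case
    proof (cases "e \<in> far_class c i")
      case True
      then have "ends e = {y, z}"
        using step names_in_star by (auto simp: far_class_def split_ends_def split: if_splits)
      then have "conn ends (far_class c i) y z" using True by (rule conn_edge[rotated])
      then show ?thesis using step.IH by (meson conn_trans)
    next
      case False
      then have e: "e \<in> new_class c i" using step by auto
      then have "tip ` pair_of e = {y, z}"
        using step by (simp add: new_class_def split_ends_def)
      then have "z \<in> tip ` pair_of e" by simp
      then obtain b where "b \<in> pair_of e" "tip b = z" by (auto elim: imageE)
      then show ?thesis using e by (auto simp: new_star_def)
    qed
  qed
  then show ?thesis by (meson conn_sym)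
qed

text \<open>A candidate for the star edges of color \<open>i\<close> in a lift. The far and new
  edges of the color form a tree on \<open>V - {v}\<close>; a tree on \<open>V\<close> has one edge
  more, hence the bound.\<close>

definition admissible :: "('e \<Rightarrow> nat) \<Rightarrow> nat \<Rightarrow> 'e set \<Rightarrow> bool" where
  "admissible c i L \<longleftrightarrow> L \<subseteq> new_star c i \<and> card L \<le> card (new_class c i) + 1 \<and>
     (\<forall>x\<in>V - {v}. \<exists>a\<in>L. conn ends (far_class c i) x (tip a))"

text \<open>In a minimal reaching set \<open>L\<close> the tips lie in different components of the
  far class. The new edges join these components, so there are at most one more of them than new
  edges.\<close>

lemma admissible_exists:
  assumes c: "split_col c" and i: "i < k" and ne: "new_class c i \<noteq> {}"
  shows "\<exists>L. admissible c i L"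
proof -
  define \<L> where "\<L> = {L. L \<subseteq> new_star c i \<and> (\<forall>x\<in>V - {v}. \<exists>a\<in>L. conn ends (far_class c i) x (tip a))}"
  have "finite (new_star c i)" using new_star_subset finite_star finite_subset by blast
  then have "finite \<L>" unfolding \<L>_def by auto
  moreover have "new_star c i \<in> \<L>" using far_reaches_new_star[OF assms] unfolding \<L>_def by blast
  ultimately obtain L where L: "L \<in> \<L>" "\<And>M. M \<in> \<L> \<Longrightarrow> M \<subseteq> L \<Longrightarrow> L = M"
    using finite_has_minimal[of \<L>] by blast
  have Ls: "L \<subseteq> star" using L(1) new_star_subset unfolding \<L>_def by blast
  have sep: "a = b" if ab: "a \<in> L" "b \<in> L" "conn ends (far_class c i) (tip a) (tip b)" for a b
  proof (rule ccontr)
    assume "a \<noteq> b"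
    have "\<exists>d\<in>L - {a}. conn ends (far_class c i) x (tip d)" if x: "x \<in> V - {v}" for x
    proof -
      obtain d where d: "d \<in> L" "conn ends (far_class c i) x (tip d)"
        using L(1) x unfolding \<L>_def by blast
      show ?thesis
      proof (cases "d = a")
        case True
        then have "conn ends (far_class c i) x (tip b)" using d ab(3) by (meson conn_trans)
        then show ?thesis using ab \<open>a \<noteq> b\<close> by blast
      qed (use d in blast)
    qed
    then have "L - {a} \<in> \<L>" using L(1) unfolding \<L>_def by blast
    then show False using L(2)[of "L - {a}"] ab by blast
  qed
  have inj: "inj_on tip L"
  proof (rule inj_onI)
    fix a b assume "a \<in> L" "b \<in> L" "tip a = tip b"
    then show "a = b" using sep[of a b] by simp
  qed
  have tips: "tip ` L \<subseteq> V - {v}" using Ls ends_star(2) by (intro image_subsetI) (meson subsetD)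
  interpret S: tree_packing "V - {v}" split_edges split_ends k by (rule split_packing)
  have "card (tip ` L) \<le> card (new_class c i) + 1"
  proof (rule card_separated_le)
    show "finite (tip ` L)" using finite_subset[OF Ls finite_star] by simp
    show "separated split_ends (far_class c i) (tip ` L)"
      unfolding separated_def conn_split_far using sep by blast
    have "spans split_ends (far_class c i \<union> new_class c i) (V - {v})"
      using c i unfolding tree_coloring_def split_class by blast
    then show "spans split_ends (far_class c i \<union> new_class c i) (tip ` L)"
      using tips by (rule spans_subset)
    show "\<exists>x y. split_ends e = {x, y}" if "e \<in> new_class c i" for e
      using that S.ends_in[of e] by (auto simp: new_class_def split_edges_def)
  qed simp
  then have "card L \<le> card (new_class c i) + 1" using card_image[OF inj] by simp
  then show ?thesis using L(1) unfolding admissible_def \<L>_def by blast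
qed

text \<open>A color without new edges is left free at \<open>v\<close>: its far class already spans
  \<open>V - {v}\<close>, and any star edge can attach \<open>v\<close>.\<close>

definition lift :: "('e \<Rightarrow> nat) \<Rightarrow> ('e \<Rightarrow> nat) \<Rightarrow> bool" where
  "lift c' c \<longleftrightarrow> col c \<and> (\<forall>e\<in>E - star. c e = c' e) \<and>
     (\<forall>i<k. new_class c' i \<noteq> {} \<longrightarrow> star_class c i \<subseteq> new_star c' i)"

lemma lift_far_class: "lift c' c \<Longrightarrow> far_class c i = far_class c' i"
  by (auto simp: lift_def far_class_def)

lemma card_lift_star_class:
  assumes "split_col c'" "lift c' c" "i < k"
  shows "card (star_class c i) = card (new_class c' i) + 1"
  using card_far_new[OF assms(1,3)] card_far_star[of c i] assms lift_far_class[OF assms(2), of i] V2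
  by (simp add: lift_def)

lemma lift_admissible:
  assumes "split_col c'" "lift c' c" "i < k" "new_class c' i \<noteq> {}"
  shows "admissible c' i (star_class c i)"
  using card_lift_star_class[OF assms(1-3)] assms far_reaches_star[of c i] lift_far_class[OF assms(2), of i]
  unfolding admissible_def lift_def by auto

text \<open>There are only \<open>card P < k\<close> new edges to be colored.\<close>

lemma leaf_color_exists:
  assumes "split_col c"
  shows "\<exists>j<k. new_class c j = {}"
proof (rule ccontr)
  assume "\<not> ?thesis"
  then have "(\<Sum>j<k. 1) \<le> (\<Sum>j<k. card (new_class c j))"
    by (intro sum_mono) (auto simp: Suc_le_eq card_gt_0_iff)
  also have "\<dots> = card names"
    unfolding new_class_def using assms
    by (intro card_eq_sum_color_classes[symmetric]) (auto simp: tree_coloring_def split_edges_def)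
  finally show False using card_names card_P_less by simp
qed

text \<open>The pairs cover at most \<open>2 * card P\<close> star edges, fewer than
  \<open>k + card P\<close>. Such an edge can be given any color without new edges.\<close>

lemma unpaired_exists: "\<exists>u\<in>star. u \<notin> \<Union>P"
proof (rule ccontr)
  assume "\<not> ?thesis"
  then have "card star \<le> card (\<Union>P)"
    using pair_sub finite_subset[OF _ finite_star] by (intro card_mono) auto
  also have "\<dots> \<le> (\<Sum>p\<in>P. card p)" by (rule card_Union_le_sum_card)
  also have "\<dots> = 2 * card P" using card_pair by simp
  finally show False using card_star_P card_P_less by simp
qed

text \<open>With \<open>N\<close> the colors having new edges, the sets \<open>L i\<close> take at
  most \<open>card P + card N\<close> star edges. At least \<open>k - card N\<close> remain, enough
  to give one to each other color; \<open>u\<close> is among them because it is in no pair.\<close>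

lemma lift_exists:
  assumes c': "split_col c'"
    and L: "\<And>i. i < k \<Longrightarrow> new_class c' i \<noteq> {} \<Longrightarrow> admissible c' i (L i)"
    and u: "u \<in> star" "u \<notin> \<Union>P" and j: "j < k" "new_class c' j = {}"
  shows "\<exists>c. lift c' c \<and> (\<forall>i<k. new_class c' i \<noteq> {} \<longrightarrow> star_class c i = L i) \<and> c u = j"
proof -
  define Z where "Z = {i. i < k \<and> new_class c' i = {}}"
  define N where "N = {i. i < k \<and> new_class c' i \<noteq> {}}"
  define R where "R = star - (\<Union>i\<in>N. L i)"
  have Lsub: "L i \<subseteq> new_star c' i" "card (L i) \<le> card (new_class c' i) + 1" if "i \<in> N" for i
    using L that unfolding N_def admissible_def by auto
  have fin: "finite Z" "finite N" "finite R" by (auto simp: Z_def N_def R_def)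
  have LU: "(\<Union>i\<in>N. L i) \<subseteq> star" using Lsub(1) new_star_subset by blast
  have "Z \<union> N = {..<k}" "Z \<inter> N = {}" by (auto simp: Z_def N_def)
  then have ZN: "card Z + card N = k" using fin by (metis card_Un_disjoint card_lessThan)
  have names_sum: "card names = (\<Sum>i<k. card (new_class c' i))"
    unfolding new_class_def using c'
    by (intro card_eq_sum_color_classes) (auto simp: tree_coloring_def split_edges_def)
  have "card (\<Union>i\<in>N. L i) \<le> (\<Sum>i\<in>N. card (L i))" using fin(2) by (rule card_UN_le)
  also have "\<dots> \<le> (\<Sum>i\<in>N. card (new_class c' i) + 1)" using Lsub(2) by (rule sum_mono)
  also have "\<dots> = (\<Sum>i\<in>N. card (new_class c' i)) + card N" by (simp only: sum.distrib) simp
  also have "(\<Sum>i\<in>N. card (new_class c' i)) \<le> (\<Sum>i<k. card (new_class c' i))"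
    by (rule sum_mono2) (auto simp: N_def)
  finally have "card (\<Union>i\<in>N. L i) \<le> card P + card N" using names_sum card_names by simp
  moreover have "card R = card star - card (\<Union>i\<in>N. L i)"
    unfolding R_def using LU finite_subset[OF LU] by (simp add: card_Diff_subset)
  ultimately have "card Z \<le> card R" using ZN card_star_P by simp
  moreover have "u \<in> R"
  proof -
    have "new_star c' i \<subseteq> \<Union>P" for i
      using pair_of_name(1) by (auto simp: new_star_def new_class_def)
    then show ?thesis using u Lsub(1) unfolding R_def by blast
  qed
  moreover have "j \<in> Z" using j by (simp add: Z_def)
  ultimately obtain g where g: "g ` R = Z" "g u = j"
    using surjection_with_value[OF fin(3,1)] by blast
  \<comment> \<open>The description in the last case is unique because different colors have
    disjoint \<open>new_star\<close> sets.\<close>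
  define c where "c = (\<lambda>e. if e \<in> E - star then c' e else if e \<in> R then g e else (THE i. i \<in> N \<and> e \<in> L i))"
  have uniq: "i = l" if "i \<in> N" "l \<in> N" "e \<in> L i" "e \<in> L l" for i l e
    using that Lsub(1) new_star_disjoint by blast
  have cL: "c e = i" if "i \<in> N" "e \<in> L i" for e i
  proof -
    have "e \<in> star" "e \<notin> R" using that LU by (auto simp: R_def)
    moreover have "(THE i. i \<in> N \<and> e \<in> L i) = i" using that uniq by blast
    ultimately show ?thesis by (simp add: c_def)
  qed
  have cR: "c e = g e" if "e \<in> R" for e using that by (auto simp: c_def R_def)
  have cover: "e \<in> R \<or> (\<exists>i\<in>N. e \<in> L i)" if "e \<in> star" for e using that by (auto simp: R_def)
  have far: "far_class c i = far_class c' i" for i by (auto simp: far_class_def c_def)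
  have gZ: "g e \<in> Z" if "e \<in> R" for e using that g by blast
  have sN: "star_class c i = L i" if i: "i \<in> N" for i
  proof
    show "star_class c i \<subseteq> L i"
    proof
      fix e assume "e \<in> star_class c i"
      then have e: "e \<in> star" "c e = i" by (auto simp: star_class_def)
      have "e \<notin> R" using cR gZ e(2) i by (auto simp: N_def Z_def)
      then show "e \<in> L i" using cover[OF e(1)] cL e(2) by blast
    qed
    show "L i \<subseteq> star_class c i" using cL i LU by (auto simp: star_class_def)
  qed
  have sZ: "\<exists>e\<in>R. e \<in> star_class c i" if "i \<in> Z" for i
  proof -
    obtain e where "e \<in> R" "g e = i" using g \<open>i \<in> Z\<close> by blast
    then show ?thesis using cR by (auto simp: star_class_def R_def)
  qed
  have "col c"
    unfolding tree_coloring_def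
  proof (intro conjI allI impI ballI)
    fix e assume "e \<in> E"
    then consider "e \<in> E - star" | "e \<in> R" | i where "i \<in> N" "e \<in> L i" using cover by blast
    then show "c e < k"
    proof cases
      case 1
      then show ?thesis using c' by (auto simp: c_def tree_coloring_def split_edges_def)
    next
      case 2
      then show ?thesis using cR gZ by (auto simp: Z_def)
    next
      case 3
      then show ?thesis using cL by (auto simp: N_def)
    qed
  next
    fix i assume i: "i < k"
    show "spans ends {e \<in> E. c e = i} V"
      unfolding spans_class_iff far
    proof (cases "i \<in> N")
      case True
      then show "\<forall>x\<in>V - {v}. \<exists>a\<in>star_class c i. conn ends (far_class c' i) x (tip a)"
        using L i unfolding sN[OF True] admissible_def N_def by blast
    next
      case False
      then have iZ: "i \<in> Z" and ni: "new_class c' i = {}" using i by (auto simp: N_def Z_def)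
      obtain e where e: "e \<in> R" "e \<in> star_class c i" using sZ[OF iZ] by blast
      have "tip e \<in> V - {v}" using e ends_star(2) by (auto simp: R_def)
      moreover have "spans split_ends (far_class c' i \<union> new_class c' i) (V - {v})"
        using c' i unfolding tree_coloring_def split_class by blast
      ultimately have "conn ends (far_class c' i) x (tip e)" if "x \<in> V - {v}" for x
        using that unfolding ni Un_empty_right spans_def conn_split_far by blast
      then show "\<forall>x\<in>V - {v}. \<exists>a\<in>star_class c i. conn ends (far_class c' i) x (tip a)"
        using e(2) by blast
    qed
  qed
  then have "lift c' c" unfolding lift_def
    using sN Lsub(1) by (auto simp: N_def c_def)
  moreover have "c u = j" using cR \<open>u \<in> R\<close> g(2) by simp
  ultimately show ?thesis using sN by (auto simp: N_def)
qed

lemma leaf_class_eq: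
  assumes "split_col c'" "lift c' c" "j < k" "new_class c' j = {}" "u \<in> star" "c u = j"
  shows "star_class c j = {u}"
proof -
  have "card (star_class c j) = 1" using card_lift_star_class[OF assms(1-3)] assms(4) by simp
  moreover have "u \<in> star_class c j" using assms by (simp add: star_class_def)
  ultimately show ?thesis by (metis card_1_singletonE singletonD)
qed

lemma step_if_classes_eq:
  assumes "col c" "col d" "i < k" "far_class c i = far_class d i" "star_class c i = star_class d i"
  shows "step c d"
  using assms class_split unfolding coloring_step_def by metis

text \<open>Both lifts are moved to lifts giving the unpaired edge \<open>u\<close> the same color
  \<open>j\<close> without new edges. Their classes of color \<open>j\<close> then agree: the common
  far class and \<open>u\<close>.\<close>

lemma lifts_linked:
  assumes c': "split_col c'" and c: "lift c' c" and d: "lift c' d"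
  shows "linked c d"
proof -
  have cd: "col c" "col d" using c d by (auto simp: lift_def)
  obtain u where u: "u \<in> star" "u \<notin> \<Union>P" using unpaired_exists by blast
  show ?thesis
  proof (cases "\<exists>i<k. new_class c' i \<noteq> {}")
    case True
    then obtain i where i: "i < k" "new_class c' i \<noteq> {}" by blast
    obtain j where j: "j < k" "new_class c' j = {}" using leaf_color_exists[OF c'] by blast
    \<comment> \<open>The star edges of colors with new edges are kept and only the others are
      redistributed, so class \<open>i\<close> witnesses the step.\<close>
    have normal: "\<exists>b. step a b \<and> lift c' b \<and> b u = j" if a: "lift c' a" for a
    proof -
      obtain b where b: "lift c' b" "star_class b i = star_class a i" "b u = j"
        using lift_exists[OF c' lift_admissible[OF c' a] u j] i by blast
      then have "step a b"
        using a i lift_far_class[OF a] lift_far_class[OF b(1)]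
        by (intro step_if_classes_eq[of a b i]) (auto simp: lift_def)
      then show ?thesis using b by blast
    qed
    obtain c1 d1 where c1: "step c c1" "lift c' c1" "c1 u = j" and d1: "step d d1" "lift c' d1" "d1 u = j"
      using normal[OF c] normal[OF d] by blast
    have "step c1 d1"
      using c1(2) d1(2) j lift_far_class[OF c1(2)] lift_far_class[OF d1(2)]
        leaf_class_eq[OF c' c1(2) j u(1) c1(3)] leaf_class_eq[OF c' d1(2) j u(1) d1(3)]
      by (intro step_if_classes_eq[of c1 d1 j]) (auto simp: lift_def)
    then show ?thesis using c1(1) step_sym[OF d1(1)]
      by (meson converse_rtranclp_into_rtranclp rtranclp.rtrancl_refl)
  next
    case False
    define i j where "i = c u" and "j = d u"
    have ij: "i < k" "j < k" using cd u star_subset unfolding i_def j_def tree_coloring_def by auto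
    \<comment> \<open>Now every far class spans \<open>V - {v}\<close> by itself, so the star edges
      of two colors may be swapped freely. The swap brings \<open>u\<close> to its color in
      \<open>d\<close>.\<close>
    define t where "t = (\<lambda>l. if l = i then j else if l = j then i else l)"
    define c1 where "c1 = (\<lambda>e. if e \<in> star then t (c e) else c e)"
    have tt: "t (t l) = l" "t l < k \<longleftrightarrow> l < k" for l using ij by (auto simp: t_def)
    have far: "far_class c1 l = far_class c' l" for l
      using lift_far_class[OF c, of l] by (auto simp: far_class_def c1_def)
    have star1: "star_class c1 l = star_class c (t l)" for l
      using tt by (auto simp: star_class_def c1_def)
    have "col c1"
      unfolding tree_coloring_def spans_class_iff far
    proof (intro conjI ballI allI impI)
      fix e assume "e \<in> E"
      then show "c1 e < k" using cd(1) tt(2) by (auto simp: c1_def tree_coloring_def)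
    next
      fix l x assume l: "l < k" and x: "x \<in> V - {v}"
      obtain e where e: "e \<in> star_class c1 l" using star_class_ne[OF cd(1), of "t l"] tt(2) l star1 by blast
      then have "tip e \<in> V - {v}" using ends_star(2) by (auto simp: star_class_def)
      moreover have "spans split_ends (far_class c' l \<union> new_class c' l) (V - {v})"
        using c' l unfolding tree_coloring_def split_class by blast
      moreover have "new_class c' l = {}" using False l by blast
      ultimately have "conn ends (far_class c' l) x (tip e)"
        using x unfolding spans_def by (simp add: conn_split_far)
      then show "\<exists>a\<in>star_class c1 l. conn ends (far_class c' l) x (tip a)" using e by blast
    qed
    moreover from this have l1: "lift c' c1" using False c by (auto simp: lift_def c1_def)
    moreover have "step c c1"
      using cd(1) \<open>col c1\<close> by (rule step_if_two_colors[of c c1 i j]) (auto simp: c1_def t_def)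
    moreover have "step c1 d"
    proof (rule step_if_classes_eq[of c1 d j])
      have "c1 u = j" using u by (simp add: c1_def t_def i_def)
      then show "star_class c1 j = star_class d j"
        using leaf_class_eq[OF c' l1 ij(2) _ u(1)] leaf_class_eq[OF c' d ij(2) _ u(1)] False ij
        unfolding j_def by blast
      show "far_class c1 j = far_class d j" using far lift_far_class[OF d] by simp
    qed (use \<open>col c1\<close> cd ij in auto)
    ultimately show ?thesis by (meson converse_rtranclp_into_rtranclp rtranclp.rtrancl_refl)
  qed
qed

text \<open>Both lifts get the same star edges in the shared color \<open>i\<close>: the unpaired
  edge \<open>u\<close> if the color has no new edges, otherwise one common admissible set.\<close>

lemma split_step_lift:
  assumes "split_step c' d'"
  shows "\<exists>c d. lift c' c \<and> lift d' d \<and> step c d"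
proof -
  obtain i where cd: "split_col c'" "split_col d'" and i: "i < k"
    "{e \<in> split_edges. c' e = i} = {e \<in> split_edges. d' e = i}"
    using assms unfolding coloring_step_def by blast
  have far: "far_class c' i = far_class d' i"
    using i(2) by (auto simp: far_class_def split_edges_def)
  have new: "new_class c' i = new_class d' i"
    using i(2) by (auto simp: new_class_def split_edges_def)
  obtain u where u: "u \<in> star" "u \<notin> \<Union>P" using unpaired_exists by blast
  show ?thesis
  proof (cases "new_class c' i = {}")
    case True
    obtain L M where L: "\<And>i. i < k \<Longrightarrow> new_class c' i \<noteq> {} \<Longrightarrow> admissible c' i (L i)"
      and M: "\<And>i. i < k \<Longrightarrow> new_class d' i \<noteq> {} \<Longrightarrow> admissible d' i (M i)"
      using admissible_exists cd by metis
    obtain c d where c: "lift c' c" "c u = i" and d: "lift d' d" "d u = i"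
      using lift_exists[OF cd(1) L u i(1)] lift_exists[OF cd(2) M u i(1)] True new by blast
    have "star_class c i = {u}" "star_class d i = {u}"
      using leaf_class_eq[OF cd(1) c(1) i(1) _ u(1) c(2)] leaf_class_eq[OF cd(2) d(1) i(1) _ u(1) d(2)]
        True new by auto
    then have "step c d"
      using c d i far lift_far_class[OF c(1)] lift_far_class[OF d(1)]
      by (intro step_if_classes_eq[of c d i]) (auto simp: lift_def)
    then show ?thesis using c d by blast
  next
    case False
    obtain L where L: "\<And>i. i < k \<Longrightarrow> new_class c' i \<noteq> {} \<Longrightarrow> admissible c' i (L i)"
      using admissible_exists cd(1) by metis
    obtain M where M: "\<And>i. i < k \<Longrightarrow> new_class d' i \<noteq> {} \<Longrightarrow> admissible d' i (M i)"
      using admissible_exists cd(2) by metis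
    \<comment> \<open>Admissibility in color \<open>i\<close> depends only on the far and new
      classes of that color, which \<open>c'\<close> and \<open>d'\<close> share.\<close>
    have "admissible d' i (L i)"
      using L[OF i(1) False] far new unfolding admissible_def new_star_def by simp
    then have M': "\<And>l. l < k \<Longrightarrow> new_class d' l \<noteq> {} \<Longrightarrow> admissible d' l ((M(i := L i)) l)"
      using M by simp
    obtain j j' where j: "j < k" "new_class c' j = {}" and j': "j' < k" "new_class d' j' = {}"
      using leaf_color_exists cd by blast
    obtain c where c: "lift c' c" "star_class c i = L i"
      using lift_exists[OF cd(1) L u j] i False by blast
    obtain d where d: "lift d' d" "star_class d i = L i"
      using lift_exists[OF cd(2) M' u j'] i False new by (metis fun_upd_same)
    have "step c d"
      using c d i far lift_far_class[OF c(1)] lift_far_class[OF d(1)]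
      by (intro step_if_classes_eq[of c d i]) (auto simp: lift_def)
    then show ?thesis using c d by blast
  qed
qed

text \<open>Consecutive lifted steps may meet in two different lifts of the same coloring;
  \<open>lifts_linked\<close> bridges them.\<close>

lemma linked_lifts:
  assumes "split_step\<^sup>*\<^sup>* c' d'" "split_col c'" "lift c' c" "lift d' d"
  shows "linked c d"
  using assms(1,4)
proof (induction arbitrary: d rule: rtranclp_induct)
  case base
  then show ?case using lifts_linked assms by blast
next
  case (step y z)
  obtain a b where ab: "lift y a" "lift z b" "step a b" using split_step_lift[OF step.hyps(2)] by blast
  have "linked c a" using step.IH ab(1) by blast
  moreover have "linked b d"
    using lifts_linked[of z b d] step.hyps(2) ab step.prems unfolding coloring_step_def by blast
  ultimately show ?case using ab(3) by (meson converse_rtranclp_into_rtranclp rtranclp_trans)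
qed

text \<open>The same function colors both graphs, since a new edge is named by an old edge of its
  pair. A detour through \<open>v\<close> along a pair becomes the new edge.\<close>

lemma balanced_is_lift:
  assumes bal: "balanced c" and P: "star_pairs c = P"
  shows "split_col c" "lift c c"
proof -
  have c: "col c" using bal by (simp add: balanced_def)
  have new: "new_star c i = star_class c i" if "i < k" "new_class c i \<noteq> {}" for i
  proof -
    have "pair_of a = star_class c i" if a: "a \<in> new_class c i" for a
    proof -
      have a': "pair_of a \<in> star_pairs c" "a \<in> pair_of a" "c a = i"
        using a pair_of_name[of a] P by (auto simp: new_class_def)
      then obtain l where "pair_of a = star_class c l" unfolding star_pairs_def by blast
      moreover from this have "l = i" using a'(2,3) by (simp add: star_class_def)
      ultimately show ?thesis by simp
    qed
    then show ?thesis using that by (auto simp: new_star_def)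
  qed
  then show "lift c c" using c by (auto simp: lift_def)
  have "spans split_ends (far_class c i \<union> new_class c i) (V - {v})" if i: "i < k" for i
  proof -
    have reach: "\<exists>a\<in>star_class c i. conn split_ends (far_class c i \<union> new_class c i) x (tip a)"
      if x: "x \<in> V - {v}" for x
    proof -
      obtain a where a: "a \<in> star_class c i" "conn split_ends (far_class c i) x (tip a)"
        using far_reaches_star[OF c i x] unfolding conn_split_far by blast
      from a(2) have "conn split_ends (far_class c i \<union> new_class c i) x (tip a)"
        by (rule conn_mono) blast
      then show ?thesis using a by blast
    qed
    \<comment> \<open>Two different star edges of one color make up its pair, and the new edge of
      that pair joins their tips.\<close>
    have both: "conn split_ends (far_class c i \<union> new_class c i) (tip a) (tip b)"
      if ab: "a \<in> star_class c i" "b \<in> star_class c i" for a b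
    proof (cases "a = b")
      case False
      then have "card {a, b} = 2" by simp
      moreover have "card (star_class c i) \<le> 2" using bal i by (simp add: balanced_def)
      ultimately have eq: "star_class c i = {a, b}"
        using ab card_seteq[of "star_class c i" "{a, b}"] by auto
      then have p: "star_class c i \<in> P" using P i False by (auto simp: star_pairs_def)
      then have n: "name (star_class c i) \<in> new_class c i" "pair_of (name (star_class c i)) = star_class c i"
        using name_in[OF p] pair_of_eq[OF p] by (auto simp: new_class_def names_def star_class_def)
      then have "split_ends (name (star_class c i)) = {tip a, tip b}"
        using eq by (auto simp: split_ends_def new_class_def)
      then show ?thesis using n(1) by (intro conn_edge) auto
    qed simp
    show ?thesis unfolding spans_def
    proof (intro ballI)
      fix x y assume "x \<in> V - {v}" "y \<in> V - {v}"
      then obtain a b where "a \<in> star_class c i" "b \<in> star_class c i"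
        "conn split_ends (far_class c i \<union> new_class c i) x (tip a)"
        "conn split_ends (far_class c i \<union> new_class c i) y (tip b)" using reach by meson
      then show "conn split_ends (far_class c i \<union> new_class c i) x y"
        using both by (meson conn_sym conn_trans)
    qed
  qed
  then show "split_col c"
    using c names_in_star star_subset unfolding tree_coloring_def split_class
    by (auto simp: split_edges_def)
qed

end

section \<open>Linking different pairings\<close>

text \<open>The non-edges of either graph form an equivalence relation, so each graph is complete
  multipartite; the complement of such a graph cannot contain a nonempty one.\<close>

lemma multipartite_intersect:
  assumes one: "\<And>a b. G a b \<Longrightarrow> a \<in> U \<and> b \<in> U"
    "\<And>a b x. G a b \<Longrightarrow> x \<in> U \<Longrightarrow> x \<noteq> a \<Longrightarrow> x \<noteq> b \<Longrightarrow> G a x \<or> G b x"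
    "\<And>a b. G a b \<Longrightarrow> G b a" "G a0 b0"
    and two: "\<And>a b. H a b \<Longrightarrow> a \<in> U \<and> b \<in> U"
    "\<And>a b x. H a b \<Longrightarrow> x \<in> U \<Longrightarrow> x \<noteq> a \<Longrightarrow> x \<noteq> b \<Longrightarrow> H a x \<or> H b x"
    "\<And>a b. H a b \<Longrightarrow> H b a" "H p q"
  shows "\<exists>a b. G a b \<and> H a b"
proof (rule ccontr)
  assume "\<not> ?thesis"
  then have no: "\<not> G a b" if "H a b" for a b using that by blast
  have pq: "p \<in> U" "q \<in> U" "\<not> G p q" "\<not> G q p"
    using two(1)[OF two(4)] no[OF two(4)] no[OF two(3)[OF two(4)]] by auto
  \<comment> \<open>An existing edge together with the closure property leaves no vertex of
    \<open>U\<close> isolated in \<open>G\<close>.\<close>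
  have "\<exists>x. G p x"
  proof (cases "p = a0 \<or> p = b0")
    case True
    then show ?thesis using one(3,4) by blast
  next
    case False
    then have "G a0 p \<or> G b0 p" using one(2)[OF one(4) pq(1)] by blast
    then show ?thesis using one(3) by blast
  qed
  then obtain x where x: "G p x" by blast
  then have xU: "x \<in> U" using one(1) by blast
  have "x \<noteq> q" using x pq by blast
  show False
  proof (cases "x = p")
    case True
    then show False using one(2)[of p p q] x pq \<open>x \<noteq> q\<close> by blast
  next
    case False
    \<comment> \<open>\<open>H p x\<close> is impossible beside \<open>G p x\<close>, so
      \<open>x\<close> and \<open>q\<close> are adjacent in \<open>H\<close> and not in
      \<open>G\<close>. But closing \<open>G p x\<close> under \<open>q\<close> requires
      \<open>G p q\<close> or \<open>G x q\<close>.\<close>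
    then have "H p x \<or> H q x" using two(2)[OF two(4) xU] \<open>x \<noteq> q\<close> by blast
    then have "H q x" using no x by blast
    then have "\<not> G q x" using no by blast
    moreover have "G p q \<or> G x q" if "q \<noteq> p"
      using one(2)[OF x pq(2)] that \<open>x \<noteq> q\<close> by blast
    ultimately show False using pq one(3) x by blast
  qed
qed

context packing_at_vertex
begin

lemma star_pairsE:
  assumes "p \<in> star_pairs c" "a \<in> p"
  obtains b where "p = {a, b}" "b \<noteq> a" "star_class c (c a) = p" "c a < k"
proof -
  obtain i where i: "i < k" "p = star_class c i" "card p = 2"
    using assms(1) unfolding star_pairs_def by blast
  have "c a = i" using assms(2) i(2) by (simp add: star_class_def)
  have "card (p - {a}) = 1" using i(3) assms(2) by simp
  then obtain b where "p - {a} = {b}" using card_1_singletonE by blast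
  then have "p = {a, b}" "b \<noteq> a" using assms(2) by auto
  then show thesis using that i \<open>c a = i\<close> by blast
qed

lemma star_pair_subset: "p \<in> star_pairs c \<Longrightarrow> p \<subseteq> star"
  by (auto simp: star_pairs_def star_class_def)

text \<open>Equal pairs with equal names give one and the same split graph. Both colorings are
  colorings of it, so the induction hypothesis supplies a walk to lift.\<close>

lemma linked_if_same_pairs:
  assumes IH: "\<And>E' ends' c d. tree_packing (V - {v}) E' ends' k \<Longrightarrow>
      tree_coloring (V - {v}) E' ends' k c \<Longrightarrow> tree_coloring (V - {v}) E' ends' k d \<Longrightarrow>
      (coloring_step (V - {v}) (E' :: 'e set) ends' k)\<^sup>*\<^sup>* c d"
    and c: "balanced c" and d: "balanced d" and eq: "star_pairs c = star_pairs d"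
  shows "linked c d"
proof -
  interpret paired_star V E ends k v "star_pairs c" "\<lambda>p. SOME x. x \<in> p"
  proof
    fix p assume p: "p \<in> star_pairs c"
    then show "p \<subseteq> star" by (rule star_pair_subset)
    show "card p = 2" using p by (auto simp: star_pairs_def)
    then have "p \<noteq> {}" by auto
    then show "(SOME x. x \<in> p) \<in> p" by (simp add: some_in_eq)
  next
    show "card star = k + card (star_pairs c)" using c by (rule card_star_pairs)
  qed (rule star_pairs_disjoint)
  show ?thesis
    using balanced_is_lift[OF c refl] balanced_is_lift[OF d eq[symmetric]] IH[OF split_packing] linked_lifts
    by blast
qed

lemma linked_at_vertex:
  assumes IH: "\<And>E' ends' c d. tree_packing (V - {v}) E' ends' k \<Longrightarrow>
      tree_coloring (V - {v}) E' ends' k c \<Longrightarrow> tree_coloring (V - {v}) E' ends' k d \<Longrightarrow>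
      (coloring_step (V - {v}) (E' :: 'e set) ends' k)\<^sup>*\<^sup>* c d"
    and c: "col c" and d: "col d"
  shows "linked c d"
proof -
  define \<C> where "\<C> b = {a. linked b a \<and> balanced a}" for b
  obtain c0 d0 where 0: "c0 \<in> \<C> c" "d0 \<in> \<C> d"
    using linked_to_balanced[OF c] linked_to_balanced[OF d] unfolding \<C>_def by blast
  define m where "m = (\<lambda>(a, b). card (star_pairs a \<inter> star_pairs b))"
  have "m ab \<le> card (Pow star)" for ab
    unfolding m_def by (cases ab) (auto intro!: card_mono dest: star_pair_subset)
  then have "\<exists>ab. ab \<in> \<C> c \<times> \<C> d \<and> (\<forall>xy. xy \<in> \<C> c \<times> \<C> d \<longrightarrow> m xy \<le> m ab)"
    using 0 by (intro ex_has_greatest_nat[of _ "(c0, d0)" _ "Suc (card (Pow star))"])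
      (auto intro: le_imp_less_Suc)
  then obtain a b where ab: "a \<in> \<C> c" "b \<in> \<C> d"
    and max: "\<And>x y. x \<in> \<C> c \<Longrightarrow> y \<in> \<C> d \<Longrightarrow>
      card (star_pairs x \<inter> star_pairs y) \<le> card (star_pairs a \<inter> star_pairs b)"
    unfolding m_def by fastforce
  have "star_pairs a = star_pairs b"
  proof (rule ccontr)
    assume ne: "star_pairs a \<noteq> star_pairs b"
    define Q where "Q = star_pairs a \<inter> star_pairs b"
    define U where "U = star - \<Union>Q"
    \<comment> \<open>The edges of \<open>G b\<close> are the pairs that can occur beside all of the
      common pairs \<open>Q\<close> in a balanced coloring linked with \<open>b\<close>.\<close>
    define G where "G b x y \<longleftrightarrow> x \<in> U \<and> y \<in> U \<and> x \<noteq> y \<and>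
      (\<exists>a\<in>\<C> b. Q \<subseteq> star_pairs a \<and> {x, y} \<in> star_pairs a)" for b x y
    \<comment> \<open>As the numbers of pairs are equal, each coloring has a pair outside
      \<open>Q\<close>, which gives an edge in either graph.\<close>
    have "card (star_pairs a) = card (star_pairs b)"
      using card_star_pairs[of a] card_star_pairs[of b] ab unfolding \<C>_def by simp
    then have nn: "\<not> star_pairs a \<subseteq> Q" "\<not> star_pairs b \<subseteq> Q"
      using ne card_subset_eq[of "star_pairs a" "star_pairs b"]
        card_subset_eq[of "star_pairs b" "star_pairs a"] unfolding Q_def by auto
    have nonempty: "\<exists>x y. G b' x y" if a': "a' \<in> \<C> b'" "Q \<subseteq> star_pairs a'" "\<not> star_pairs a' \<subseteq> Q" for a' b'
    proof -
      obtain p where p: "p \<in> star_pairs a'" "p \<notin> Q" using a' by blast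
      then have pU: "p \<subseteq> U"
        using star_pair_subset star_pairs_disjoint a'(2) unfolding U_def by blast
      have "p \<noteq> {}" using p by (auto simp: star_pairs_def)
      then obtain x where x: "x \<in> p" by blast
      then obtain y where "p = {x, y}" "y \<noteq> x" using star_pairsE p(1) by metis
      then have "G b' x y" using p(1) pU a' unfolding G_def by blast
      then show ?thesis by blast
    qed
    have closed: "G b' x z \<or> G b' y z" if xy: "G b' x y" and z: "z \<in> U" "z \<noteq> x" "z \<noteq> y" for b' x y z
    proof -
      obtain a' where a': "a' \<in> \<C> b'" "Q \<subseteq> star_pairs a'" "{x, y} \<in> star_pairs a'"
        using xy unfolding G_def by blast
      have U: "x \<in> U" "y \<in> U" "x \<noteq> y" using xy unfolding G_def by auto
      have bal: "balanced a'" "linked b' a'" using a' unfolding \<C>_def by auto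
      have i: "a' x < k" "star_class a' (a' x) = {x, y}"
        using star_pairsE[OF a'(3), of x] by auto
      have zs: "z \<in> star" using z by (simp add: U_def)
      obtain d' p where d': "linked a' d'" "balanced d'" "p \<in> star_pairs d'" "p = {x, z} \<or> p = {y, z}"
        "\<forall>l<k. l \<noteq> a' x \<longrightarrow> l \<noteq> a' z \<longrightarrow> star_class d' l = star_class a' l"
        using pair_exchange[OF bal(1) i U(3) zs z(2,3)] by blast
      have "d' \<in> \<C> b'" using bal(2) d' unfolding \<C>_def by auto
      \<comment> \<open>The exchange touches only the colors of \<open>x\<close> and
        \<open>z\<close>, and neither vertex of \<open>G\<close> lies in a pair of
        \<open>Q\<close>.\<close>
      moreover have "Q \<subseteq> star_pairs d'"
      proof
        fix q assume q: "q \<in> Q"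
        then obtain l where l: "l < k" "card (star_class a' l) = 2" "q = star_class a' l"
          using a'(2) unfolding star_pairs_def by blast
        have "x \<notin> q" "z \<notin> q" using U z q unfolding U_def by auto
        then have "l \<noteq> a' x" "l \<noteq> a' z" using l(3) i(2) zs by (auto simp: star_class_def)
        then have "star_class d' l = q" using d'(5) l by blast
        then show "q \<in> star_pairs d'" using l unfolding star_pairs_def by force
      qed
      ultimately show ?thesis using d'(3,4) U z unfolding G_def by blast
    qed
    have "\<exists>x y. G c x y \<and> G d x y"
    proof -
      obtain x y where xy: "G c x y" using nonempty[OF ab(1)] nn unfolding Q_def by blast
      obtain x' y' where xy': "G d x' y'" using nonempty[OF ab(2)] nn unfolding Q_def by blast
      have sym: "G b' t s" if "G b' s t" for b' s t
        using that unfolding G_def by (metis insert_commute)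
      have inU: "s \<in> U \<and> t \<in> U" if "G b' s t" for b' s t
        using that unfolding G_def by blast
      show ?thesis by (rule multipartite_intersect[where G = "G c" and H = "G d" and U = U,
            OF inU closed sym xy inU closed sym xy'])
    qed
    then obtain x y where "G c x y" "G d x y" by blast
    then obtain a' b' where a': "a' \<in> \<C> c" "b' \<in> \<C> d" "insert {x, y} Q \<subseteq> star_pairs a' \<inter> star_pairs b'"
      and "x \<in> U" unfolding G_def by blast
    then have "{x, y} \<notin> Q" "finite Q" unfolding U_def Q_def by auto
    \<comment> \<open>A common edge of the two graphs would be one more common pair, against the
      maximal choice of \<open>a\<close> and \<open>b\<close>.\<close>
    then have "card Q < card (insert {x, y} Q)" by simp
    also have "\<dots> \<le> card (star_pairs a' \<inter> star_pairs b')"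
      using a'(3) by (intro card_mono) auto
    finally show False using max[OF a'(1,2)] unfolding Q_def by simp
  qed
  then have "linked a b"
    using linked_if_same_pairs[OF IH] ab unfolding \<C>_def by blast
  moreover have "linked c a" "linked b d"
    using ab linked_sym unfolding \<C>_def by auto
  ultimately show ?thesis by (meson rtranclp_trans)
qed

end

section \<open>Induction on the number of vertices\<close>

theorem tree_colorings_linked:
  assumes "tree_packing V E ends k" "tree_coloring V E ends k c" "tree_coloring V E ends k d"
  shows "(coloring_step V E ends k)\<^sup>*\<^sup>* c d"
  using assms
proof (induction "card V" arbitrary: V E ends c d rule: less_induct)
  case less
  interpret tree_packing V E ends k by fact
  have c: "col c" and d: "col d" by fact+
  show ?case
  proof (cases "card V = 1")
    case True
    then have "E = {}" using cardE finE by simp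
    then have "step c d" using c d k3 unfolding coloring_step_def by (auto intro: exI[of _ 0])
    then show ?thesis by blast
  next
    case False
    then have V2: "2 \<le> card V" using V_ne finV by (metis One_nat_def Suc_leI card_gt_0_iff le_neq_implies_less one_add_one plus_1_eq_Suc)
    \<comment> \<open>Double counting: an edge has at most two ends, so the degrees add up to at
      most \<open>2 * k * (card V - 1)\<close>.\<close>
    have "\<exists>v\<in>V. card {e \<in> E. v \<in> ends e} < 2 * k"
    proof (rule ccontr)
      assume "\<not> ?thesis"
      then have "(\<Sum>v\<in>V. 2 * k) \<le> (\<Sum>v\<in>V. card {e \<in> E. v \<in> ends e})" by (intro sum_mono) auto
      also have "\<dots> = (\<Sum>e\<in>E. card {v \<in> V. v \<in> ends e})"
        using finV finE by (intro sum_multicount_gen) auto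
      also have "\<dots> \<le> (\<Sum>e\<in>E. 2)"
      proof (rule sum_mono)
        fix e assume "e \<in> E"
        then obtain x y where "ends e = {x, y}" using ends_in by blast
        then have "card {v \<in> V. v \<in> ends e} \<le> card {x, y}" by (intro card_mono) auto
        also have "\<dots> \<le> 2" by (simp add: card_insert_if)
        finally show "card {v \<in> V. v \<in> ends e} \<le> 2" .
      qed
      finally have "card V * k \<le> (card V - 1) * k" using cardE by (simp add: ac_simps)
      then show False using V2 k3 by simp
    qed
    then obtain v where v: "v \<in> V" "card {e \<in> E. v \<in> ends e} < 2 * k" by blast
    interpret packing_at_vertex V E ends k v
    proof
      show "ends e \<noteq> {v}" if "e \<in> E" for e using class_cut[OF c that, of v v] by auto
    qed (use v V2 in auto)
    have "card (V - {v}) < card V" using v finV by (meson card_Diff1_less)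
    then show ?thesis using linked_at_vertex[OF _ c d] less.hyps by blast
  qed
qed

section \<open>Bases of the cycle matroid as spanning trees\<close>

lemma simple_path_exists:
  assumes "conn ends F a b"
  shows "\<exists>vs es. length vs = Suc (length es) \<and> vs ! 0 = a \<and> vs ! length es = b \<and> distinct vs \<and>
    set es \<subseteq> F \<and> (\<forall>i<length es. ends (es ! i) = {vs ! i, vs ! Suc i})"
  using assms
proof (induction rule: conn_induct)
  case refl
  show ?case by (intro exI[of _ "[a]"] exI[of _ "[]"]) simp
next
  case (step y z e)
  then obtain vs es where p: "length vs = Suc (length es)" "vs ! 0 = a" "vs ! length es = y" "distinct vs"
    "set es \<subseteq> F" "\<forall>i<length es. ends (es ! i) = {vs ! i, vs ! Suc i}" by blast
  show ?case
  proof (cases "z \<in> set vs")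
    case True
    \<comment> \<open>The walk returns to a vertex of the path, so the path is cut back to that
      vertex.\<close>
    then obtain m where m: "m < length vs" "vs ! m = z" by (auto simp: in_set_conv_nth)
    have "set (take m es) \<subseteq> F" using p(5) set_take_subset by fastforce
    then show ?thesis using p m
      by (intro exI[of _ "take (Suc m) vs"] exI[of _ "take m es"]) auto
  next
    case False
    have "ends ((es @ [e]) ! i) = {(vs @ [z]) ! i, (vs @ [z]) ! Suc i}" if "i < length (es @ [e])" for i
      using that p step by (cases "i < length es") (auto simp: nth_append less_Suc_eq)
    then show ?thesis using p False step
      by (intro exI[of _ "vs @ [z]"] exI[of _ "es @ [e]"]) (auto simp: nth_append)
  qed
qed

lemma edge_closes_cycle:
  assumes "conn ends F a b" "ends e = {a, b}" "e \<notin> F"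
  shows "\<exists>C\<subseteq>insert e F. is_cycle ends C"
proof -
  obtain vs es where p: "length vs = Suc (length es)" "vs ! 0 = a" "vs ! length es = b" "distinct vs"
    "set es \<subseteq> F" "\<forall>i<length es. ends (es ! i) = {vs ! i, vs ! Suc i}"
    using simple_path_exists[OF assms(1)] by blast
  have "distinct es"
    unfolding distinct_conv_nth
  proof (intro allI impI)
    fix i j assume ij: "i < length es" "j < length es" "i \<noteq> j"
    show "es ! i \<noteq> es ! j"
    proof
      assume "es ! i = es ! j"
      then have "{vs ! i, vs ! Suc i} = {vs ! j, vs ! Suc j}" using p(6) ij by metis
      then show False using ij p(1,4) by (auto simp: doubleton_eq_iff nth_eq_iff_index_eq)
    qed
  qed
  moreover have "ends ((es @ [e]) ! i) = {vs ! i, vs ! ((i + 1) mod length (es @ [e]))}"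
    if "i < length (es @ [e])" for i
  proof (cases "i < length es")
    case True
    then have "(i + 1) mod length (es @ [e]) = Suc i" by (subst mod_less) auto
    then show ?thesis using p(6) True by (simp add: nth_append)
  next
    case False
    then have "i = length es" using that by simp
    then show ?thesis using assms(2) p(2,3) by (simp add: insert_commute)
  qed
  ultimately have "is_cycle ends (set (es @ [e]))"
    unfolding is_cycle_def using p(1,4,5) assms(3)
    by (intro exI[of _ vs] exI[of _ "es @ [e]"]) auto
  then show ?thesis using p(5) by (intro exI[of _ "set (es @ [e])"]) auto
qed

lemma cycle_edge_redundant:
  assumes "is_cycle ends C" "e \<in> C" "ends e = {x, y}"
  shows "conn ends (C - {e}) x y"
proof -
  obtain vs es where c: "es \<noteq> []" "length vs = length es" "distinct es" "set es = C"
    "\<forall>i<length es. ends (es ! i) = {vs ! i, vs ! ((i + 1) mod length es)}"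
    using assms(1) unfolding is_cycle_def by blast
  let ?n = "length es"
  obtain j where j: "j < ?n" "es ! j = e" using assms(2) c(4) by (auto simp: in_set_conv_nth)
  \<comment> \<open>Walk around the cycle starting just behind \<open>e\<close>; for
    \<open>m < ?n\<close> edge \<open>j\<close> is not met again, and \<open>m = ?n - 1\<close>
    arrives at its other end.\<close>
  have "conn ends (C - {e}) (vs ! ((j + 1) mod ?n)) (vs ! ((j + 1 + m) mod ?n))" if "m < ?n" for m
    using that
  proof (induction m)
    case (Suc m)
    let ?i = "(j + 1 + m) mod ?n"
    have i: "?i < ?n" using c(1) by simp
    have "?i \<noteq> j"
    proof
      assume ij: "?i = j"
      show False
      proof (cases "j + 1 + m < ?n")
        case True
        then have "?i = j + 1 + m" by (rule mod_less)
        then show False using ij by simp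
      next
        case False
        then have "?i = (j + 1 + m - ?n) mod ?n" by (simp add: le_mod_geq)
        also have "\<dots> = j + 1 + m - ?n" using j Suc.prems by (intro mod_less) simp
        finally show False using ij False Suc.prems by simp
      qed
    qed
    then have "es ! ?i \<in> C - {e}" using c(3,4) i j by (auto simp: nth_eq_iff_index_eq)
    moreover have "(?i + 1) mod ?n = (j + 1 + Suc m) mod ?n" by (simp add: mod_Suc_eq)
    then have "ends (es ! ?i) = {vs ! ?i, vs ! ((j + 1 + Suc m) mod ?n)}" using c(5) i by metis
    ultimately have "conn ends (C - {e}) (vs ! ?i) (vs ! ((j + 1 + Suc m) mod ?n))"
      by (rule conn_edge)
    then show ?case using Suc by (meson Suc_lessD conn_trans)
  qed simp
  from this[of "?n - 1"] have "conn ends (C - {e}) (vs ! ((j + 1) mod ?n)) (vs ! j)"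
    using c(1) j by (simp add: Suc_leI)
  moreover have "{x, y} = {vs ! j, vs ! ((j + 1) mod ?n)}" using assms(3) c(5) j by metis
  then have "x = vs ! j \<and> y = vs ! ((j + 1) mod ?n) \<or> y = vs ! j \<and> x = vs ! ((j + 1) mod ?n)"
    by (auto simp: doubleton_eq_iff)
  ultimately show ?thesis using conn_sym by metis
qed

text \<open>Removing \<open>e\<close> splits a component of the forest. At least one end of
  \<open>e\<close> is then cut off from all of \<open>I\<close> and can join \<open>I\<close>, which
  makes up for the lost edge.\<close>

lemma card_acyclic_le:
  assumes "finite F" "acyclic_edges ends F" "finite V" "I \<subseteq> V" "separated ends F I"
    and "\<And>e. e \<in> F \<Longrightarrow> \<exists>x\<in>V. \<exists>y\<in>V. ends e = {x, y}"
  shows "card I + card F \<le> card V"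
  using assms(1,2,4,5,6)
proof (induction F arbitrary: I rule: finite_induct)
  case empty
  then show ?case using assms(3) by (simp add: card_mono)
next
  case (insert e F)
  obtain a b where ab: "a \<in> V" "b \<in> V" "ends e = {a, b}" using insert.prems by blast
  have nab: "\<not> conn ends F a b"
    using edge_closes_cycle[of ends F a b e] ab insert unfolding acyclic_edges_def by blast
  have ac: "acyclic_edges ends F" using insert.prems(1) unfolding acyclic_edges_def by blast
  let ?conn = "conn ends (insert e F)"
  have cab: "?conn a b" using ab by (intro conn_edge[of e]) auto
  have up: "?conn s t" if "conn ends F s t" for s t using that by (rule conn_mono) blast
  have sepF: "separated ends F I" using insert.prems(3) up unfolding separated_def by blast
  have "\<exists>c\<in>{a, b}. \<forall>x\<in>I. \<not> conn ends F x c"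
  proof (rule ccontr)
    assume "\<not> ?thesis"
    then obtain x y where xy: "x \<in> I" "conn ends F x a" "y \<in> I" "conn ends F y b" by blast
    then have "?conn x y" using up cab by (meson conn_sym conn_trans)
    then have "x = y" using xy insert.prems(3) unfolding separated_def by blast
    then show False using xy nab by (meson conn_sym conn_trans)
  qed
  then obtain z where z: "z \<in> V" "\<forall>x\<in>I. \<not> conn ends F x z" using ab by blast
  then have "z \<notin> I" by auto
  have "separated ends F (insert z I)"
    using sepF z conn_sym[of ends F z] unfolding separated_def by blast
  then have "card (insert z I) + card F \<le> card V"
    using insert.IH[of "insert z I"] ac insert.prems z by auto
  moreover have "finite I" using insert.prems(2) assms(3) finite_subset by blast
  ultimately show ?case using \<open>z \<notin> I\<close> insert.hyps by simp
qed

lemma conn_image: "conn ends F x y \<Longrightarrow> conn (\<lambda>e. \<phi> ` ends e) F (\<phi> x) (\<phi> y)"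
proof (induction rule: conn_induct)
  case (step y z e)
  then have "conn (\<lambda>e. \<phi> ` ends e) F (\<phi> y) (\<phi> z)" by (intro conn_edge[of e]) auto
  then show ?case using step.IH by (meson conn_trans)
qed simp

text \<open>Gluing one chosen vertex of every component to a single vertex \<open>root\<close> keeps the cycle matroid
  and makes the graph connected.\<close>

locale glued_graph =
  fixes V :: "'v set" and E :: "'e set" and ends :: "'e \<Rightarrow> 'v set" and r0 :: 'v
  assumes graph: "graph V E ends" and r0: "r0 \<in> V"
begin

text \<open>Connected vertices get the same choice, so the fixed points of \<open>rep\<close> in
  \<open>V\<close> are the chosen vertices, one per component.\<close>

definition rep :: "'v \<Rightarrow> 'v" where "rep x = (SOME y. y \<in> V \<and> conn ends E x y)"
definition root :: 'v where "root = rep r0"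
definition glue :: "'v \<Rightarrow> 'v" where "glue x = (if rep x = x then root else x)"
definition glued_vertices :: "'v set" where "glued_vertices = glue ` V"
definition glued_ends :: "'e \<Rightarrow> 'v set" where "glued_ends e = glue ` ends e"

lemma finV: "finite V" and finE: "finite E"
  using graph by (auto simp: graph_def)

lemma ends_in: "e \<in> E \<Longrightarrow> \<exists>x\<in>V. \<exists>y\<in>V. ends e = {x, y}"
proof -
  assume "e \<in> E"
  then have e: "ends e \<subseteq> V" "card (ends e) = 1 \<or> card (ends e) = 2" using graph by (auto simp: graph_def)
  then obtain x y where "ends e = {x, y}" by (metis card_1_singletonE card_2_iff insert_absorb2)
  then show ?thesis using e by auto
qed

lemma rep_eq: "conn ends E x y \<Longrightarrow> rep x = rep y"
proof -
  assume "conn ends E x y"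
  then have "(\<lambda>z. z \<in> V \<and> conn ends E x z) = (\<lambda>z. z \<in> V \<and> conn ends E y z)"
    by (intro ext) (meson conn_sym conn_trans)
  then show ?thesis by (simp add: rep_def)
qed

lemma rep_props: "x \<in> V \<Longrightarrow> rep x \<in> V" "x \<in> V \<Longrightarrow> conn ends E x (rep x)"
proof -
  assume "x \<in> V"
  then have "x \<in> V \<and> conn ends E x x" by simp
  then have "rep x \<in> V \<and> conn ends E x (rep x)" unfolding rep_def by (rule someI)
  then show "rep x \<in> V" "conn ends E x (rep x)" by auto
qed

lemma rep_rep: "x \<in> V \<Longrightarrow> rep (rep x) = rep x"
  using rep_eq rep_props by metis

lemma root_props: "root \<in> V" "rep root = root" "glue root = root"
  using rep_props rep_rep r0 by (auto simp: root_def glue_def)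

lemma glue_eq_nonrep: "glue x = glue y \<Longrightarrow> rep x \<noteq> x \<Longrightarrow> x = y"
  using root_props by (auto simp: glue_def split: if_splits)

lemma glued_vertices_eq: "glued_vertices = insert root (V - {x \<in> V. rep x = x})"
  using root_props by (auto simp: glued_vertices_def glue_def image_iff)

lemma card_glued: "card glued_vertices - 1 = card V - card {x \<in> V. rep x = x}"
  unfolding glued_vertices_eq using root_props finV by (simp add: card_Diff_subset)

text \<open>\<open>F\<close> has the same components as the whole graph; for subsets of
  \<open>E\<close> these are the spanning sets of the cycle matroid.\<close>

definition spanning :: "'e set \<Rightarrow> bool" where
  "spanning F \<longleftrightarrow> (\<forall>e\<in>E. \<forall>x y. ends e = {x, y} \<longrightarrow> conn ends F x y)"

lemma spans_glued:
  assumes "spanning F"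
  shows "spans glued_ends F glued_vertices"
proof (rule spansI_root[where r = root])
  fix z assume "z \<in> glued_vertices"
  then obtain x where x: "x \<in> V" "z = glue x" by (auto simp: glued_vertices_def)
  have "conn ends F x (rep x)"
    using conn_lift[OF rep_props(2)[OF x(1)], of ends F] assms unfolding spanning_def by blast
  then have "conn glued_ends F (glue x) (glue (rep x))"
    unfolding glued_ends_def by (rule conn_image)
  moreover have "glue (rep x) = root" using x rep_rep by (simp add: glue_def)
  ultimately show "conn glued_ends F z root" using x by simp
qed

text \<open>After its last visit to \<open>root\<close>, a walk in the glued graph lifts to the
  original one, because \<open>glue\<close> is injective off the representatives. The lifted part
  starts at the representative of its component.\<close>

lemma spanning_if_spans_glued:
  assumes F: "F \<subseteq> E" and sp: "spans glued_ends F glued_vertices"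
  shows "spanning F"
proof -
  have key: "\<forall>x\<in>V. glue x = z \<longrightarrow> conn ends F x (rep x)" if "conn glued_ends F root z" for z
    using that
  proof (induction rule: conn_induct)
    case refl
    show ?case
    proof (intro ballI impI)
      fix x assume "glue x = root"
      then have "rep x = x" using root_props by (auto simp: glue_def split: if_splits)
      then show "conn ends F x (rep x)" by simp
    qed
  next
    case (step y z e)
    show ?case
    proof (intro ballI impI)
      fix x assume x: "x \<in> V" "glue x = z"
      show "conn ends F x (rep x)"
      proof (cases "rep x = x")
        case False
        obtain s t where st: "s \<in> V" "t \<in> V" "ends e = {s, t}" using ends_in step F by blast
        then have "{glue s, glue t} = {y, z}" using step by (simp add: glued_ends_def)
        then have "\<exists>a b. a \<in> V \<and> ends e = {a, b} \<and> glue a = y \<and> glue b = z"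
          using st by (auto simp: doubleton_eq_iff insert_commute)
        then obtain a b where ab: "a \<in> V" "ends e = {a, b}" "glue a = y" "glue b = z" by blast
        have bx: "b = x" using glue_eq_nonrep[of x b] x ab False by simp
        have "conn ends F a x" using step ab bx by (intro conn_edge[of e]) auto
        moreover have "rep a = rep x"
          using F step ab bx by (intro rep_eq conn_edge[of e]) auto
        moreover have "conn ends F a (rep a)" using step.IH ab by blast
        ultimately show ?thesis by (metis conn_sym conn_trans)
      qed simp
    qed
  qed
  have to_rep: "conn ends F x (rep x)" if "x \<in> V" for x
    using key[of "glue x"] sp that root_props unfolding spans_def glued_vertices_def
    by (metis imageI)
  show ?thesis unfolding spanning_def
  proof (intro ballI allI impI)
    fix e x y assume e: "e \<in> E" "ends e = {x, y}"
    then have "x \<in> V" "y \<in> V" using ends_in[of e] by (auto simp: doubleton_eq_iff)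
    moreover have "rep x = rep y" using e by (intro rep_eq conn_edge[of e]) auto
    ultimately show "conn ends F x y" using to_rep by (metis conn_sym conn_trans)
  qed
qed

lemma glued_ends_in: "e \<in> E \<Longrightarrow> \<exists>x\<in>glued_vertices. \<exists>y\<in>glued_vertices. glued_ends e = {x, y}"
  using ends_in[of e] unfolding glued_vertices_def glued_ends_def by fastforce

lemma card_spanning:
  assumes "F \<subseteq> E" "spanning F"
  shows "card glued_vertices - 1 \<le> card F"
proof -
  have "card glued_vertices \<le> card F + 1"
  proof (rule card_le_if_spans)
    show "\<exists>x y. glued_ends e = {x, y}" if "e \<in> F" for e using that assms(1) glued_ends_in by blast
  qed (use assms spans_glued finE finV finite_subset glued_vertices_def in auto)
  then show ?thesis by simp
qed

text \<open>The representatives lie in different components, so \<open>card_acyclic_le\<close>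
  applies to them.\<close>

lemma card_acyclic:
  assumes "F \<subseteq> E" "acyclic_edges ends F"
  shows "card F \<le> card glued_vertices - 1"
proof -
  let ?I = "{x \<in> V. rep x = x}"
  have "separated ends F ?I"
    unfolding separated_def
  proof (intro ballI impI)
    fix x y assume xy: "x \<in> ?I" "y \<in> ?I" "conn ends F x y"
    then have "conn ends E x y" using assms(1) by (blast intro: conn_mono)
    then have "rep x = rep y" by (rule rep_eq)
    then show "x = y" using xy by simp
  qed
  then have "card ?I + card F \<le> card V"
    using assms finV finE ends_in by (intro card_acyclic_le[where V = V]) (auto intro: finite_subset)
  then show ?thesis using card_glued by simp
qed

text \<open>By maximality an outside edge closes a cycle with \<open>B\<close>, and the rest of that
  cycle joins its ends.\<close>

lemma base_spanning:
  assumes "cm_base E ends B"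
  shows "spanning B"
  unfolding spanning_def
proof (intro ballI allI impI)
  fix e x y assume e: "e \<in> E" "ends e = {x, y}"
  have B: "B \<subseteq> E" "acyclic_edges ends B" "\<And>F. B \<subset> F \<Longrightarrow> F \<subseteq> E \<Longrightarrow> \<not> acyclic_edges ends F"
    using assms unfolding cm_base_def by auto
  show "conn ends B x y"
  proof (cases "e \<in> B")
    case False
    then have "\<not> acyclic_edges ends (insert e B)" using B e by (intro B(3)) auto
    then obtain C where C: "C \<subseteq> insert e B" "is_cycle ends C" unfolding acyclic_edges_def by blast
    then have "e \<in> C" using B(2) unfolding acyclic_edges_def by blast
    then have "conn ends (C - {e}) x y" using cycle_edge_redundant C e by metis
    then show ?thesis by (rule conn_mono) (use C in blast)
  qed (use e in \<open>auto intro: conn_edge\<close>)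
qed

lemma card_base:
  assumes "cm_base E ends B"
  shows "card B = card glued_vertices - 1"
  using card_spanning[of B] card_acyclic[of B] base_spanning[OF assms] assms
  unfolding cm_base_def by auto

lemma cm_rank_eq:
  assumes "cm_base E ends B"
  shows "cm_rank E ends = card glued_vertices - 1"
  unfolding cm_rank_def
proof (rule Max_eqI)
  have "{card F |F. F \<subseteq> E \<and> acyclic_edges ends F} \<subseteq> card ` Pow E" by auto
  then show "finite {card F |F. F \<subseteq> E \<and> acyclic_edges ends F}"
    using finE finite_subset by blast
  show "card glued_vertices - 1 \<in> {card F |F. F \<subseteq> E \<and> acyclic_edges ends F}"
    using card_base[OF assms] assms unfolding cm_base_def by auto
qed (use card_acyclic in auto)

text \<open>An edge on a cycle of \<open>B\<close> could be dropped, leaving a spanning set that is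
  too small; a larger acyclic set would exceed the bound of \<open>card_acyclic\<close>.\<close>

lemma baseI:
  assumes B: "B \<subseteq> E" "card B = card glued_vertices - 1" and sp: "spans glued_ends B glued_vertices"
  shows "cm_base E ends B"
proof -
  have fB: "finite B" using B finE finite_subset by blast
  have "acyclic_edges ends B"
    unfolding acyclic_edges_def
  proof
    assume "\<exists>C\<subseteq>B. is_cycle ends C"
    then obtain C where C: "C \<subseteq> B" "is_cycle ends C" by blast
    then obtain e where e: "e \<in> C" unfolding is_cycle_def by fastforce
    then have eB: "e \<in> B" using C by blast
    have drop: "conn ends (B - {e}) s t" if st: "ends e = {s, t}" for s t
      using cycle_edge_redundant[OF C(2) e st] by (rule conn_mono) (use C in blast)
    have "spanning (B - {e})"
      unfolding spanning_def
    proof (intro ballI allI impI)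
      fix f x y assume f: "f \<in> E" "ends f = {x, y}"
      then have "conn ends B x y" using spanning_if_spans_glued[OF B(1) sp] unfolding spanning_def by blast
      then show "conn ends (B - {e}) x y"
      proof (rule conn_lift)
        fix g s t assume g: "g \<in> B" "ends g = {s, t}"
        then show "conn ends (B - {e}) s t"
          by (cases "g = e") (use drop in \<open>auto intro: conn_edge\<close>)
      qed
    qed
    then have "card B \<le> card (B - {e})" using card_spanning[of "B - {e}"] B by auto
    then show False using fB eB by (meson card_Diff1_less not_le)
  qed
  moreover have "\<not> acyclic_edges ends F" if "B \<subset> F" "F \<subseteq> E" for F
  proof
    assume "acyclic_edges ends F"
    then have "card F \<le> card B" using card_acyclic that B by simp
    moreover have "card B < card F" using that finE finite_subset psubset_card_mono by blast
    ultimately show False by simp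
  qed
  ultimately show ?thesis using B unfolding cm_base_def by blast
qed

section \<open>Vertices of the base graph as colorings\<close>

lemma kbase_vertices_as_colorings:
  assumes X: "X \<in> kbase_vertices k E ends" and k: "3 \<le> k" and card: "card E = k * cm_rank E ends"
  shows "tree_packing glued_vertices E glued_ends k" "2 \<le> card glued_vertices"
    "\<exists>c. tree_coloring glued_vertices E glued_ends k c \<and> X = (\<lambda>i. {e \<in> E. c e = i}) ` {..<k}"
proof -
  let ?n = "card glued_vertices - 1"
  have X': "finite X" "card X = k" "\<And>B. B \<in> X \<Longrightarrow> cm_base E ends B"
    "\<And>B D. B \<in> X \<Longrightarrow> D \<in> X \<Longrightarrow> B \<noteq> D \<Longrightarrow> B \<inter> D = {}"
    using X unfolding kbase_vertices_def by auto
  have "X \<noteq> {}" using X' k by auto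
  then obtain B0 where B0: "B0 \<in> X" by blast
  have cE: "card E = k * ?n" using card cm_rank_eq[OF X'(3)[OF B0]] by simp
  show "tree_packing glued_vertices E glued_ends k"
    using finV finE r0 glued_ends_in cE k by unfold_locales (auto simp: glued_vertices_def)
  have sub: "B \<subseteq> E" if "B \<in> X" for B using X'(3)[OF that] by (simp add: cm_base_def)
  have fB: "finite B" if "B \<in> X" for B using sub[OF that] finE finite_subset by blast
  show "2 \<le> card glued_vertices"
  proof (rule ccontr)
    assume "\<not> ?thesis"
    \<comment> \<open>Rank 0 would make the empty set the only base, too few for \<open>k\<close>
      distinct ones.\<close>
    then have "B = {}" if "B \<in> X" for B using card_base[OF X'(3)[OF that]] fB[OF that] by simp
    then have "X \<subseteq> {{}}" by blast
    then have "card X \<le> card {{} :: 'e set}" by (intro card_mono) auto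
    then show False using X'(2) k by simp
  qed
  \<comment> \<open>The \<open>k\<close> disjoint bases together have as many edges as
    \<open>E\<close>, so they partition \<open>E\<close> and the index of a base can serve as a
    color.\<close>
  have "card (\<Union>X) = (\<Sum>B\<in>X. card B)"
    using X' fB by (intro card_Union_disjoint) (auto simp: pairwise_def disjnt_def)
  also have "\<dots> = (\<Sum>B\<in>X. ?n)" using card_base X'(3) by (intro sum.cong) auto
  finally have "card (\<Union>X) = card E" using cE X'(2) by simp
  then have UX: "\<Union>X = E" using sub finE by (intro card_subset_eq) auto
  obtain h where h: "bij_betw h {..<k} X"
    using finite_same_card_bij[of "{..<k}" X] X' by auto
  define c where "c e = (THE i. i < k \<and> e \<in> h i)" for e
  have hX: "h i \<in> X" if "i < k" for i using that h by (auto simp: bij_betw_def)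
  have ceq: "c e = i" if "i < k" "e \<in> h i" for e i
  proof -
    have "l = i" if "l < k" "e \<in> h l" for l
    proof -
      have "h l = h i" using X'(4)[OF hX hX] that \<open>i < k\<close> \<open>e \<in> h i\<close> by blast
      then show ?thesis using h that \<open>i < k\<close> by (auto simp: bij_betw_def inj_on_def)
    qed
    then show ?thesis unfolding c_def using that by blast
  qed
  have ex: "\<exists>i<k. e \<in> h i" if "e \<in> E" for e using that UX h by (auto simp: bij_betw_def)
  have cls: "{e \<in> E. c e = i} = h i" if "i < k" for i
    using ceq ex sub[OF hX[OF that]] that by blast
  have "X = (\<lambda>i. {e \<in> E. c e = i}) ` {..<k}" using cls h by (auto simp: bij_betw_def)
  moreover have "tree_coloring glued_vertices E glued_ends k c"
    unfolding tree_coloring_def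
    using ceq ex cls hX X'(3) base_spanning spans_glued by metis
  ultimately show "\<exists>c. tree_coloring glued_vertices E glued_ends k c \<and> X = (\<lambda>i. {e \<in> E. c e = i}) ` {..<k}"
    by blast
qed

text \<open>With at least two glued vertices no class is empty, so different colors have different
  classes and there are exactly \<open>k\<close> of them.\<close>

lemma coloring_classes_kbase_vertex:
  assumes "tree_packing glued_vertices E glued_ends k" "2 \<le> card glued_vertices"
    and c: "tree_coloring glued_vertices E glued_ends k c"
  shows "(\<lambda>i. {e \<in> E. c e = i}) ` {..<k} \<in> kbase_vertices k E ends"
proof -
  interpret tree_packing glued_vertices E glued_ends k by fact
  let ?W = "\<lambda>i. {e \<in> E. c e = i}"
  have size: "card (?W i) = card glued_vertices - 1" if "i < k" for i using card_class[OF c that] .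
  have "inj_on ?W {..<k}"
  proof (rule inj_onI)
    fix i j assume ij: "i \<in> {..<k}" "j \<in> {..<k}" "?W i = ?W j"
    have "card (?W i) \<noteq> 0" using size ij assms(2) by simp
    then have "?W i \<noteq> {}" by (metis card.empty)
    then show "i = j" using ij(3) by blast
  qed
  then have "card (?W ` {..<k}) = k" by (simp add: card_image)
  moreover have "cm_base E ends (?W i)" if "i < k" for i
    using size[OF that] c that by (intro baseI) (auto simp: tree_coloring_def)
  ultimately show ?thesis unfolding kbase_vertices_def by auto
qed

lemma kbase_connected_glued:
  assumes k: "3 \<le> k" and card: "card E = k * cm_rank E ends"
  shows "kbase_connected k E ends"
  unfolding kbase_connected_def
proof (intro ballI)
  fix X Y assume X: "X \<in> kbase_vertices k E ends" and Y: "Y \<in> kbase_vertices k E ends"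
  note tp = kbase_vertices_as_colorings(1,2)[OF X k card]
  let ?W = "\<lambda>c. (\<lambda>i. {e \<in> E. c e = i}) ` {..<k}"
  obtain c d where c: "tree_coloring glued_vertices E glued_ends k c" "X = ?W c"
    and d: "tree_coloring glued_vertices E glued_ends k d" "Y = ?W d"
    using kbase_vertices_as_colorings(3)[OF X k card] kbase_vertices_as_colorings(3)[OF Y k card] by blast
  have "(kbase_adj k E ends)\<^sup>*\<^sup>* (?W c) (?W d)"
    using tree_colorings_linked[OF tp(1) c(1) d(1)]
  proof (induction rule: rtranclp_induct)
    case (step a b)
    then obtain i where ab: "tree_coloring glued_vertices E glued_ends k a"
      "tree_coloring glued_vertices E glued_ends k b" "i < k" "{e \<in> E. a e = i} = {e \<in> E. b e = i}"
      unfolding coloring_step_def by blast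
    have "{e \<in> E. a e = i} \<in> ?W a" "{e \<in> E. a e = i} \<in> ?W b" using ab(3,4) by auto
    then have "?W a \<inter> ?W b \<noteq> {}" by blast
    \<comment> \<open>A step may merely permute colors, in which case the two vertices
      coincide.\<close>
    then have "?W a = ?W b \<or> kbase_adj k E ends (?W a) (?W b)"
      using coloring_classes_kbase_vertex[OF tp] ab(1,2) unfolding kbase_adj_def by blast
    then show ?case using step.IH by (metis (no_types, lifting) rtranclp.rtrancl_into_rtrancl)
  qed simp
  then show "(kbase_adj k E ends)\<^sup>*\<^sup>* X Y" using c d by simp
qed

end

theorem theorem3p1:
  fixes V :: "'v set" and E :: "'e set" and ends :: "'e \<Rightarrow> 'v set" and k :: nat
  assumes "graph V E ends"
    and "card E = k * cm_rank E ends"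
    and "k \<ge> 3"
  shows "kbase_connected k E ends"
proof (cases "V = {}")
  case True
  then have "E = {}" using assms(1) by (auto simp: graph_def)
  then have "kbase_vertices k E ends = {}"
  proof -
    \<comment> \<open>Without edges only the empty set can be a base, so there are no
      \<open>k\<close> distinct bases and the base graph has no vertices.\<close>
    have "X \<subseteq> {{}}" if "X \<in> kbase_vertices k E ends" for X
      using that \<open>E = {}\<close> by (auto simp: kbase_vertices_def cm_base_def)
    then have "card X \<le> 1" if "X \<in> kbase_vertices k E ends" for X
      using that card_mono[of "{{}}" X] by fastforce
    then show ?thesis using assms(3) by (fastforce simp: kbase_vertices_def)
  qed
  then show ?thesis by (simp add: kbase_connected_def)
next
  case False
  then obtain r0 where "r0 \<in> V" by blast
  then interpret glued_graph V E ends r0 using assms(1) by unfold_locales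
  show ?thesis using kbase_connected_glued assms(2,3) by blast
qed

end
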